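(* Let $n,k,d$ be integers with $1\le n\leq k\leq d$, and let $\mu_1,\ldots,\mu_{n+d-k}$ be mass assignments on $G_k(\mathbb{R}^d)$. Then there exists a $k$-dimensional linear subspace $h$ of $\mathbb{R}^d$ such that the mass distributions $\mu_1^h,\ldots,\mu_{n+d-k}^h$ on $h$ have a common $(n-1,k)$-center transversal; that is, there is an $(n-1)$-dimensional affine subspace $g\subseteq h$ such that for every $i\in\{1,\ldots,n+d-k\}$, every closed halfspace of $h$ containing $g$ contains at least a $\frac{1}{k-n+2}$-fraction of the total mass $\mu_i^h(h)$.
   Context: A ($k$-dimensional) mass distribution $\mu$ on a $k$-dimensional real Euclidean space $h$ (for instance $\mathbb{R}^k$ or a $k$-dimensional linear subspace of $\mathbb{R}^d$) is a measure on $h$ such that all open subsets of $h$ are measurable, $0<\mu(h)<\infty$, and $\mu(S)=0$ for every lower-dimensional subset $S$ of $h$ (in particular for every affine hyperplane of $h$). $G_k(\mathbb{R}^d)$ is the Grassmann manifold of all $k$-dimensional linear subspaces of $\mathbb{R}^d$. A mass assignment on $G_k(\mathbb{R}^d)$ is a continuous assignment $\mu$ which maps each $h\in G_k(\mathbb{R}^d)$ to a $k$-dimensional mass distribution $\mu^h:=\mu(h)$ on $h$. Continuity is with respect to the weak topology: regarding $\mu^h$ as a measure on $\mathbb{R}^d$ supported on $h$, the map $h\mapsto\int f\,d\mu^h$ is continuous for every bounded continuous $f:\mathbb{R}^d\to\mathbb{R}$. Given mass distributions on a $k$-dimensional space $h$, a common $(n-1,k)$-center transversal is an $(n-1)$-dimensional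 affine subspace $g$ of $h$ such that every halfspace of $h$ containing $g$ contains at least a $\frac{1}{k-n+2}$-fraction of each mass. *)

theory Defs
  imports "HOL-Analysis.Analysis"
begin

definition grassmannian :: "nat \<Rightarrow> 'a::euclidean_space set set" where
  "grassmannian k = {h. subspace h \<and> dim h = k}"

definition orthonormal_frames :: "nat \<Rightarrow> (nat \<Rightarrow> 'a::euclidean_space) set" where
  "orthonormal_frames k =
    {v \<in> extensional {..<k}. \<forall>i<k. \<forall>j<k. v i \<bullet> v j = (if i = j then 1 else 0)}"

definition stiefel_topology :: "nat \<Rightarrow> (nat \<Rightarrow> 'a::euclidean_space) topology" where
  "stiefel_topology k =
    subtopology (product_topology (\<lambda>_. euclidean) {..<k}) (orthonormal_frames k)"

definition frame_span :: "nat \<Rightarrow> (nat \<Rightarrow> 'a::euclidean_space) \<Rightarrow> 'a set" where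
  "frame_span k v = span (v ` {..<k})"

text \<open>The Grassmann manifold carries the quotient topology of the Stiefel manifold of
  orthonormal \<open>k\<close>-frames; see \<open>quotient_map_frame_span\<close> below.\<close>

definition grassmannian_topology :: "nat \<Rightarrow> 'a::euclidean_space set topology" where
  "grassmannian_topology k =
    topology (\<lambda>U. U \<subseteq> grassmannian k \<and>
      openin (stiefel_topology k) {v \<in> orthonormal_frames k. frame_span k v \<in> U})"

text \<open>A measure \<open>M\<close> on the linear subspace \<open>h\<close> has \<open>space M = h\<close>. Its \<open>\<sigma>\<close>-algebra may be
  larger than the Borel sets of \<open>h\<close>. A set is lower-dimensional when its affine
  hull has smaller dimension than \<open>h\<close>, i.e. when it lies in an affine hyperplane of \<open>h\<close>;
  this is the weakest reading of the null-set condition.\<close>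

definition mass_distribution :: "'a::euclidean_space set \<Rightarrow> 'a measure \<Rightarrow> bool" where
  "mass_distribution h M \<longleftrightarrow>
    space M = h \<and>
    (\<forall>U. openin (top_of_set h) U \<longrightarrow> U \<in> sets M) \<and>
    0 < emeasure M h \<and> emeasure M h < \<infinity> \<and>
    (\<forall>S \<in> sets M. aff_dim S < int (dim h) \<longrightarrow> emeasure M S = 0)"

text \<open>Since \<open>space (\<mu> h) = h\<close>, the Bochner integral below is the integral over \<open>h\<close>, which is the
  integral over the whole space with respect to the push-forward of \<open>\<mu> h\<close> under inclusion.
  Values of \<open>\<mu>\<close> outside the Grassmannian play no role.\<close>

definition mass_assignment :: "nat \<Rightarrow> ('a::euclidean_space set \<Rightarrow> 'a measure) \<Rightarrow> bool" where
  "mass_assignment k \<mu> \<longleftrightarrow>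
    (\<forall>h \<in> grassmannian k. mass_distribution h (\<mu> h)) \<and>
    (\<forall>f :: 'a \<Rightarrow> real. continuous_on UNIV f \<and> bounded (range f) \<longrightarrow>
      continuous_map (grassmannian_topology k) euclideanreal (\<lambda>h. integral\<^sup>L (\<mu> h) f))"

definition closed_halfspace_in :: "'a::euclidean_space set \<Rightarrow> 'a set \<Rightarrow> bool" where
  "closed_halfspace_in h H \<longleftrightarrow> (\<exists>a \<in> h. \<exists>b. a \<noteq> 0 \<and> H = {x \<in> h. a \<bullet> x \<le> b})"

text \<open>\<open>common_center_transversal n k h I M g\<close>: \<open>g\<close> is a common \<open>(n - 1, k)\<close>-center transversal
  of the measures \<open>M i\<close>, \<open>i \<in> I\<close>, on the \<open>k\<close>-dimensional space \<open>h\<close>.\<close>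

definition common_center_transversal ::
  "nat \<Rightarrow> nat \<Rightarrow> 'a::euclidean_space set \<Rightarrow> 'i set \<Rightarrow> ('i \<Rightarrow> 'a measure) \<Rightarrow> 'a set \<Rightarrow> bool" where
  "common_center_transversal n k h I M g \<longleftrightarrow>
    affine g \<and> g \<subseteq> h \<and> aff_dim g = int n - 1 \<and>
    (\<forall>i \<in> I. \<forall>H. closed_halfspace_in h H \<and> g \<subseteq> H \<longrightarrow>
      measure (M i) H \<ge> 1 / (real k - real n + 2) * measure (M i) h)"

lemma openin_grassmannian_topology:
  "openin (grassmannian_topology k) U \<longleftrightarrow> U \<subseteq> grassmannian k \<and>
    openin (stiefel_topology k) {v \<in> orthonormal_frames k. frame_span k v \<in> U}"
proof -
  let ?Q = "\<lambda>U :: 'a set set. {v \<in> orthonormal_frames k. frame_span k v \<in> U}"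
  have "openin (stiefel_topology k) (?Q (S \<inter> T))"
    if "openin (stiefel_topology k) (?Q S)" "openin (stiefel_topology k) (?Q T)"
    for S T :: "'a set set"
  proof -
    have "?Q (S \<inter> T) = ?Q S \<inter> ?Q T" by auto
    with openin_Int[OF that] show ?thesis by simp
  qed
  moreover have "openin (stiefel_topology k) (?Q (\<Union>K))"
    if "\<forall>U\<in>K. openin (stiefel_topology k) (?Q U)" for K :: "'a set set set"
  proof -
    have "?Q (\<Union>K) = \<Union>(?Q ` K)" by auto
    moreover have "openin (stiefel_topology k) (\<Union>(?Q ` K))"
      using that by (intro openin_Union) auto
    ultimately show ?thesis by simp
  qed
  ultimately have
    "istopology (\<lambda>U. U \<subseteq> grassmannian k \<and> openin (stiefel_topology k) (?Q U))"
    unfolding istopology_def by (simp add: Sup_le_iff le_infI1)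
  then show ?thesis
    by (simp add: grassmannian_topology_def topology_inverse')
qed

lemma topspace_stiefel_topology: "topspace (stiefel_topology k) = orthonormal_frames k"
  by (auto simp: stiefel_topology_def orthonormal_frames_def PiE_def)

lemma frame_span_in_grassmannian:
  assumes "v \<in> orthonormal_frames k"
  shows "frame_span k v \<in> grassmannian k"
proof -
  have o: "v i \<bullet> v j = (if i = j then 1 else 0)" if "i < k" "j < k" for i j
    using assms that by (auto simp: orthonormal_frames_def)
  have inj: "inj_on v {..<k}"
    by (rule inj_onI) (metis lessThan_iff o zero_neq_one)
  have "pairwise orthogonal (v ` {..<k})"
    using o by (auto simp: pairwise_def orthogonal_def)
  moreover have "0 \<notin> v ` {..<k}"
    using o by force
  ultimately have "independent (v ` {..<k})"
    by (rule pairwise_orthogonal_independent)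
  then have "dim (span (v ` {..<k})) = k"
    using inj by (simp add: dim_eq_card_independent card_image)
  then show ?thesis
    by (simp add: frame_span_def grassmannian_def)
qed

lemma frame_span_image: "frame_span k ` orthonormal_frames k = grassmannian k"
proof (intro equalityI subsetI)
  fix h :: "'a set" assume "h \<in> grassmannian k"
  then have "subspace h" and dim: "dim h = k"
    by (auto simp: grassmannian_def)
  then obtain B where B: "pairwise orthogonal B" "\<And>x. x \<in> B \<Longrightarrow> norm x = 1"
    "independent B" "card B = dim h" "span B = h"
    by (metis orthonormal_basis_subspace)
  then have "finite B" by (simp add: independent_imp_finite)
  then obtain f where f: "bij_betw f {..<k} B"
    using ex_bij_betw_nat_finite[of B] B(4) dim by (auto simp: atLeast0LessThan)
  define v where "v = restrict f {..<k}"
  have img: "v ` {..<k} = B"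
    using f by (auto simp: v_def bij_betw_def)
  have "v i \<bullet> v j = (if i = j then 1 else 0)" if "i < k" "j < k" for i j
  proof -
    have "f i \<in> B" "f j \<in> B" "i \<noteq> j \<Longrightarrow> f i \<noteq> f j"
      using f that by (auto simp: bij_betw_def inj_on_def)
    then show ?thesis
      using B that by (auto simp: v_def pairwise_def orthogonal_def norm_eq_1)
  qed
  then have "v \<in> orthonormal_frames k"
    by (auto simp: orthonormal_frames_def v_def)
  moreover have "frame_span k v = h"
    using B img by (simp add: frame_span_def)
  ultimately show "h \<in> frame_span k ` orthonormal_frames k" by blast
qed (auto simp: frame_span_in_grassmannian)

lemma topspace_grassmannian_topology: "topspace (grassmannian_topology k) = grassmannian k"
proof -
  have "{v \<in> orthonormal_frames k. frame_span k v \<in> grassmannian k} = orthonormal_frames k"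
    using frame_span_in_grassmannian by blast
  then have "openin (grassmannian_topology k) (grassmannian k :: 'a set set)"
    by (metis openin_grassmannian_topology openin_topspace order_refl topspace_stiefel_topology)
  then show ?thesis
    by (meson openin_grassmannian_topology openin_subset openin_topspace subset_antisym)
qed

lemma quotient_map_frame_span:
  "quotient_map (stiefel_topology k) (grassmannian_topology k) (frame_span k)"
  unfolding quotient_map_def topspace_grassmannian_topology topspace_stiefel_topology
  by (simp add: frame_span_image openin_grassmannian_topology)

end

theory Submission
  imports Defs "HOL-Library.Z2"
begin

text \<open>For an orthonormal \<open>k\<close>-frame \<open>v\<close>, let \<open>h\<close> be its span and \<open>L\<close> the span of its first \<open>m = k - n + 1\<close>
  vectors. Projecting the masses on \<open>h\<close> to \<open>L\<close>, each of them has a centerpoint of depth \<open>1/(m + 1)\<close> by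
  Helly's theorem; up to an arbitrarily small loss of depth it can be chosen continuously in \<open>v\<close> and
  depending only on \<open>L\<close> and \<open>h\<close>. The centerpoints of all \<open>d - m + 1\<close> masses coincide at a common zero of
  \<open>d - m\<close> sections of the tautological bundle, and the flat through the common point orthogonal to \<open>L\<close>
  in \<open>h\<close> is the transversal.

  Both orthonormality of the frame and vanishing of the components of the sections are equations for
  functions on a product of \<open>k\<close> spheres that are even or odd in each factor, so everything reduces to a
  Borsuk-Ulam theorem for products of spheres. Cohomologically it says that a product of linear forms
  is nonzero in the mod 2 cohomology ring of a product of projective spaces. The proof carries this
  out in the cubical complex of a fine grid: the signs of the functions define cochains whose cup
  product is invariant under the sign changes, its total over a product of hemispheres is computed by
  Stokes' theorem, and a cell on which it does not vanish is one near which every function changes its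
  sign.\<close>

section \<open>Cubical cochains mod 2 on the boundary of a cube\<close>

text \<open>The number of masses is what the dimensions allow. With \<open>s = d - m\<close>
  sections, the frame vector with index \<open>j < m\<close> carries \<open>s\<close> vanishing
  components and \<open>j\<close> orthogonality relations to earlier vectors. The largest total,
  \<open>s + m - 1 = d - 1\<close>, is exactly the dimension of its sphere. Continuity is the
  obstacle in choosing centerpoints. For a fixed point \<open>q\<close> of the ambient space and a
  level \<open>c < 1 / (m + 1)\<close>, being deeper than \<open>c\<close> is an open condition on
  the frame, because the directions in \<open>L\<close> form a compact sphere. So finitely many
  constant points serve all frames. For a fixed frame the points of depth at least \<open>c\<close>
  form an intersection of halfspaces, so averaging deep points with continuous weights keeps the
  depth. Only inner products with vectors of \<open>L\<close> matter, so \<open>q\<close> need not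
  lie in \<open>L\<close> and acts through its projection, a section of the tautological bundle. The
  loss of depth is removed by a limit \<open>c\<close> to \<open>1 / (m + 1)\<close>. There the
  common points could escape to infinity while the frame varies; tightness of the masses, uniform
  over the compact set of frames, prevents it.\<close>

declare add_bit_eq_xor [simp del] mult_bit_eq_and [simp del]


lemma bit_double [simp]: "x + x = (0::bit)"
  by (cases x) auto

text \<open>Off the diagonal the terms for \<open>(x, y)\<close> and \<open>(y, x)\<close> cancel in
  characteristic 2. This is the common core of \<open>cobd_cobd\<close> and
  \<open>pcobd_pcobd\<close>, with \<open>x\<close> and \<open>y\<close> the two directions of
  differentiation.\<close>

lemma sum_bit_symmetric_zero:
  fixes h :: "'a \<Rightarrow> 'a \<Rightarrow> bit"
  assumes "finite A" "\<And>x y. h x y = h y x" "\<And>x. h x x = 0"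
  shows "(\<Sum>x\<in>A. \<Sum>y\<in>A. h x y) = 0"
  using assms(1)
proof (induction A rule: finite_induct)
  case (insert a A)
  have "(\<Sum>x\<in>insert a A. \<Sum>y\<in>insert a A. h x y)
      = h a a + (\<Sum>y\<in>A. h a y) + ((\<Sum>x\<in>A. h x a) + (\<Sum>x\<in>A. \<Sum>y\<in>A. h x y))"
    using insert.hyps by (simp add: sum.distrib)
  also have "(\<Sum>x\<in>A. h x a) = (\<Sum>y\<in>A. h a y)"
    by (simp add: assms(2))
  finally show ?case using insert.IH assms(3) by simp
qed simp

text \<open>An integer vector encodes a cell of the grid with vertices in \<open>2\<int>\<close>: the cell is the product of the
  points \<open>r j\<close> for even \<open>r j\<close> and the open intervals from \<open>r j - 1\<close> to \<open>r j + 1\<close> for odd \<open>r j\<close>.\<close>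

definition edge_diff :: "nat \<Rightarrow> ((nat \<Rightarrow> int) \<Rightarrow> bit) \<Rightarrow> (nat \<Rightarrow> int) \<Rightarrow> bit" where
  "edge_diff j f r = (if odd (r j) then f (r(j := r j + 1)) + f (r(j := r j - 1)) else 0)"

text \<open>The cellular coboundary mod 2, on functions of cells of all dimensions at once. No
  grading is kept: the number of odd coordinates already gives the dimension of a cell.\<close>

definition cobd :: "nat \<Rightarrow> ((nat \<Rightarrow> int) \<Rightarrow> bit) \<Rightarrow> (nat \<Rightarrow> int) \<Rightarrow> bit" where
  "cobd d f r = (\<Sum>j<d. edge_diff j f r)"

lemma edge_diff_self: "edge_diff j (edge_diff j f) = (\<lambda>r. 0)"
  by (auto simp: edge_diff_def)

lemma edge_diff_commute: "edge_diff i (edge_diff j f) = edge_diff j (edge_diff i f)"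
  by (cases "i = j") (auto simp: edge_diff_def fun_eq_iff fun_upd_twist add_ac)

lemma edge_diff_sum: "edge_diff j (\<lambda>r. \<Sum>x\<in>A. f x r) = (\<lambda>r. \<Sum>x\<in>A. edge_diff j (f x) r)"
  by (auto simp: edge_diff_def fun_eq_iff sum.distrib)

lemma edge_diff_add: "edge_diff j (\<lambda>r. f r + g r) r = edge_diff j f r + edge_diff j g r"
  by (auto simp: edge_diff_def)

lemma cobd_add: "cobd d (\<lambda>r. f r + g r) r = cobd d f r + cobd d g r"
  by (simp add: cobd_def edge_diff_add sum.distrib)

lemma cobd_zero [simp]: "cobd d (\<lambda>r. 0) r = 0"
  by (auto simp: cobd_def edge_diff_def intro!: sum.neutral)

lemma cobd_cobd: "cobd d (cobd d f) r = 0"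
proof -
  have "cobd d (cobd d f) r = (\<Sum>i<d. \<Sum>j<d. edge_diff i (edge_diff j f) r)"
    unfolding cobd_def[abs_def] by (simp add: edge_diff_sum)
  also have "\<dots> = 0"
    by (rule sum_bit_symmetric_zero) (simp_all add: edge_diff_self edge_diff_commute)
  finally show ?thesis .
qed

definition row_neg :: "nat \<Rightarrow> (nat \<Rightarrow> int) \<Rightarrow> nat \<Rightarrow> int" where
  "row_neg d r = (\<lambda>j\<in>{..<d}. - r j)"

lemma row_neg_row_neg: "r \<in> extensional {..<d} \<Longrightarrow> row_neg d (row_neg d r) = r"
  by (auto simp: row_neg_def fun_eq_iff extensional_def)

lemma row_neg_upd: "j < d \<Longrightarrow> row_neg d (r(j := a)) = (row_neg d r)(j := - a)"
  by (auto simp: row_neg_def fun_eq_iff)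

lemma cobd_row_neg: "cobd d (\<lambda>r. f (row_neg d r)) r = cobd d f (row_neg d r)"
  unfolding cobd_def
proof (rule sum.cong)
  fix j assume "j \<in> {..<d}"
  then have j: "j < d" by simp
  have 1: "row_neg d r j = - r j" using j by (simp add: row_neg_def)
  have "- (r j + 1) = row_neg d r j - 1" "- (r j - 1) = row_neg d r j + 1"
    using 1 by auto
  then show "edge_diff j (\<lambda>r. f (row_neg d r)) r = edge_diff j f (row_neg d r)"
    using j 1 unfolding edge_diff_def row_neg_upd[OF j] 
    by (simp add: add.commute) (metis add.commute uminus_add_conv_diff)
qed simp

section \<open>Stokes' theorem for boxes, discs and hemispheres\<close>

definition odds :: "int \<Rightarrow> int \<Rightarrow> int set" where
  "odds lo hi = {a. odd a \<and> lo < a \<and> a < hi}"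

lemma finite_odds [simp]: "finite (odds lo hi)"
  by (rule finite_subset[of _ "{lo..hi}"]) (auto simp: odds_def)

text \<open>Telescoping mod 2: an interior grid point is an endpoint of two edges and
  cancels.\<close>

lemma sum_odds:
  fixes \<phi> :: "int \<Rightarrow> bit"
  assumes "even lo" "even hi" "lo < hi"
  shows "(\<Sum>a\<in>odds lo hi. \<phi> (a + 1) + \<phi> (a - 1)) = \<phi> lo + \<phi> hi"
proof -
  have "(\<Sum>a\<in>odds lo (lo + 2 * int (Suc q)). \<phi> (a + 1) + \<phi> (a - 1)) = \<phi> lo + \<phi> (lo + 2 * int (Suc q))" for q
  proof (induction q)
    case 0
    have "odds lo (lo + 2) = {lo + 1}" using assms(1) by (auto simp: odds_def)
    then show ?case by (simp add: add.commute)
  next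
    case (Suc q)
    define h where "h = lo + 2 * int (Suc q)"
    have "even h" "lo < h" using assms(1) by (auto simp: h_def)
    then have "odds lo (h + 2) = insert (h + 1) (odds lo h)"
      by (auto simp: odds_def) presburger+
    moreover have "h + 1 \<notin> odds lo h" by (simp add: odds_def)
    moreover have "lo + 2 * int (Suc (Suc q)) = h + 2" by (simp add: h_def)
    moreover have "\<phi> (h + 1 + 1) + \<phi> (h + 1 - 1) + (\<phi> lo + \<phi> h) = \<phi> lo + \<phi> (h + 2)"
      by (cases "\<phi> h"; cases "\<phi> lo"; cases "\<phi> (h + 2)") (simp_all add: add.assoc)
    ultimately show ?case using Suc.IH[folded h_def]
      by (metis finite_odds sum.insert)
  qed
  moreover obtain q where "hi = lo + 2 * int (Suc q)"
  proof -
    have "even (hi - lo)" "hi - lo > 0" using assms by auto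
    then obtain t where "hi - lo = 2 * t" by (elim evenE)
    with \<open>lo < hi\<close> have "hi - lo = 2 * t" "t > 0" by auto
    then show thesis using that[of "nat (t - 1)"] by (auto simp: algebra_simps)
  qed
  ultimately show ?thesis by blast
qed

lemma sum_PiE_remove:
  fixes f :: "('i \<Rightarrow> 'b) \<Rightarrow> 'c::comm_monoid_add"
  assumes "i \<in> I"
  shows "(\<Sum>y\<in>PiE I B. f y) = (\<Sum>g\<in>PiE (I - {i}) B. \<Sum>a\<in>B i. f (g(i := a)))"
proof -
  have I: "I = insert i (I - {i})" using assms by auto
  have "(\<Sum>y\<in>PiE I B. f y) = (\<Sum>y\<in>(\<lambda>(a, g). g(i := a)) ` (B i \<times> PiE (I - {i}) B). f y)"
    by (subst I, subst PiE_insert_eq) simp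
  also have "\<dots> = (\<Sum>(a, g)\<in>B i \<times> PiE (I - {i}) B. f (g(i := a)))"
    by (subst sum.reindex[OF inj_combinator]) (auto simp: case_prod_beta)
  also have "\<dots> = (\<Sum>a\<in>B i. \<Sum>g\<in>PiE (I - {i}) B. f (g(i := a)))"
    by (simp add: sum.cartesian_product)
  finally show ?thesis by (subst sum.swap)
qed

lemma PiE_upd_cong: "PiE (I - {i}) (B(i := X)) = PiE (I - {i}) B"
  by (rule PiE_cong) auto

lemma sum_edge_diff_box:
  fixes B :: "nat \<Rightarrow> int set"
  assumes "j < d" "B j = odds lo hi" "even lo" "even hi" "lo < hi"
  shows "(\<Sum>r\<in>PiE {..<d} B. edge_diff j f r) = (\<Sum>r\<in>PiE {..<d} (B(j := {lo, hi})). f r)"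
proof -
  have "(\<Sum>r\<in>PiE {..<d} B. edge_diff j f r)
      = (\<Sum>g\<in>PiE ({..<d} - {j}) B. \<Sum>a\<in>odds lo hi. f (g(j := a + 1)) + f (g(j := a - 1)))"
    using assms(1) by (subst sum_PiE_remove[of j]) (auto simp: assms(2) edge_diff_def odds_def intro!: sum.cong)
  also have "\<dots> = (\<Sum>g\<in>PiE ({..<d} - {j}) B. f (g(j := lo)) + f (g(j := hi)))"
    by (intro sum.cong refl sum_odds[where \<phi> = "\<lambda>a. f (_(j := a))"] assms)
  also have "\<dots> = (\<Sum>r\<in>PiE {..<d} (B(j := {lo, hi})). f r)"
    using assms by (subst (2) sum_PiE_remove[of j]) (auto simp: PiE_upd_cong)
  finally show ?thesis .
qed

text \<open>The top cells of the flat disc \<open>[-N, N]^n\<close> in the first \<open>n\<close>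
  coordinates. \<open>half_box\<close> keeps the half on which the last of these is positive,
  \<open>hemi_face\<close> takes one coordinate of the half disc of dimension \<open>n + 1\<close>
  to its outer boundary, and the union \<open>hemi\<close> of these faces is the upper hemisphere of
  dimension \<open>n\<close>.\<close>

definition cube_cells :: "nat \<Rightarrow> int \<Rightarrow> nat \<Rightarrow> (nat \<Rightarrow> int) set" where
  "cube_cells d N n = PiE {..<d} (\<lambda>j. if j < n then odds (- N) N else {0})"

definition half_box :: "int \<Rightarrow> nat \<Rightarrow> nat \<Rightarrow> int set" where
  "half_box N n j = (if j < n then odds (if Suc j = n then 0 else - N) N else {0})"

definition hemi_face :: "nat \<Rightarrow> int \<Rightarrow> nat \<Rightarrow> nat \<Rightarrow> (nat \<Rightarrow> int) set" where
  "hemi_face d N n j = PiE {..<d} ((half_box N (Suc n))(j := if j = n then {N} else {- N, N}))"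

definition hemi :: "nat \<Rightarrow> int \<Rightarrow> nat \<Rightarrow> (nat \<Rightarrow> int) set" where
  "hemi d N n = (\<Union>j\<le>n. hemi_face d N n j)"

lemma finite_half_box [simp]: "finite (half_box N n j)"
  by (simp add: half_box_def)

lemma finite_hemi_face [simp]: "finite (hemi_face d N n j)"
  by (auto simp: hemi_face_def intro!: finite_PiE)

lemma finite_hemi [simp]: "finite (hemi d N n)"
  by (simp add: hemi_def)

lemma finite_cube_cells [simp]: "finite (cube_cells d N n)"
  by (auto simp: cube_cells_def intro!: finite_PiE)

text \<open>As mod 2 chains, the boundary of the half cube consists of a hemisphere and a flat disc, which
  reduces the boundary of the hemisphere to that of the disc.\<close>

lemma sum_half_box_cobd:
  assumes "n < d" "even N" "N > 0"
  shows "(\<Sum>r\<in>PiE {..<d} (half_box N (Suc n)). cobd d f r)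
      = (\<Sum>r\<in>hemi d N n. f r) + (\<Sum>r\<in>cube_cells d N n. f r)"
proof -
  let ?B = "half_box N (Suc n)"
  let ?S = "\<lambda>j. \<Sum>r\<in>PiE {..<d} ?B. edge_diff j f r"
  have 0: "?S j = 0" if "j \<in> {..<d} - {..n}" for j
  proof (rule sum.neutral, rule ballI)
    fix r assume "r \<in> PiE {..<d} ?B"
    then have "r j \<in> ?B j" using that by (auto simp: PiE_iff)
    then have "r j = 0" using that by (auto simp: half_box_def)
    then show "edge_diff j f r = 0" by (simp add: edge_diff_def)
  qed
  have lt: "?S j = (\<Sum>r\<in>hemi_face d N n j. f r)" if "j < n" for j
  proof -
    have "?S j = (\<Sum>r\<in>PiE {..<d} (?B(j := {-N, N})). f r)"
      by (rule sum_edge_diff_box) (use that assms in \<open>auto simp: half_box_def\<close>)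
    then show ?thesis using that by (simp add: hemi_face_def)
  qed
  have "?S n = (\<Sum>r\<in>PiE {..<d} (?B(n := {0, N})). f r)"
    by (rule sum_edge_diff_box) (use assms in \<open>auto simp: half_box_def\<close>)
  also have "\<dots> = (\<Sum>r\<in>PiE {..<d} (?B(n := {0})). f r) + (\<Sum>r\<in>PiE {..<d} (?B(n := {N})). f r)"
    using assms by (simp add: sum_PiE_remove[of n] PiE_upd_cong sum.distrib)
  also have "PiE {..<d} (?B(n := {0})) = cube_cells d N n"
    unfolding cube_cells_def by (rule PiE_cong) (auto simp: half_box_def)
  also have "PiE {..<d} (?B(n := {N})) = hemi_face d N n n" by (simp add: hemi_face_def)
  finally have eq: "?S n = (\<Sum>r\<in>cube_cells d N n. f r) + (\<Sum>r\<in>hemi_face d N n n. f r)" .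
  \<comment> \<open>In face \<open>i\<close> the coordinate \<open>i\<close> is \<open>N\<close> or
    \<open>-N\<close>, which is even; in face \<open>j\<close> the same coordinate is odd.\<close>
  have disj: "hemi_face d N n i \<inter> hemi_face d N n j = {}" if "i \<le> n" "j \<le> n" "i \<noteq> j" for i j
  proof (rule ccontr)
    assume "hemi_face d N n i \<inter> hemi_face d N n j \<noteq> {}"
    then obtain r where r: "r \<in> hemi_face d N n i" "r \<in> hemi_face d N n j" by blast
    have i: "i \<in> {..<d}" using that assms(1) by auto
    have "r i \<in> (?B(i := if i = n then {N} else {- N, N})) i"
      "r i \<in> (?B(j := if j = n then {N} else {- N, N})) i"
      using PiE_mem[OF r(1)[unfolded hemi_face_def] i] PiE_mem[OF r(2)[unfolded hemi_face_def] i] by auto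
    then have "r i \<in> {-N, N}" "r i \<in> ?B i"
      using that by (auto split: if_splits)
    moreover have "even a" if "a \<in> {-N, N}" for a using that assms by auto
    ultimately show False using that by (auto simp: half_box_def odds_def)
  qed
  have "(\<Sum>r\<in>PiE {..<d} ?B. cobd d f r) = (\<Sum>j<d. ?S j)"
    unfolding cobd_def by (rule sum.swap)
  also have "\<dots> = (\<Sum>j\<le>n. ?S j)"
    using assms(1) 0 by (intro sum.mono_neutral_right) auto
  also have "\<dots> = (\<Sum>j\<le>n. \<Sum>r\<in>hemi_face d N n j. f r) + (\<Sum>r\<in>cube_cells d N n. f r)"
    by (simp add: lessThan_Suc_atMost[symmetric] eq ac_simps) (simp add: lt)
  also have "(\<Sum>j\<le>n. \<Sum>r\<in>hemi_face d N n j. f r) = (\<Sum>r\<in>hemi d N n. f r)"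
    unfolding hemi_def by (rule sum.UNION_disjoint[symmetric]) (use disj in auto)
  finally show ?thesis .
qed

lemma cube_cells_extensional: "r \<in> cube_cells d N n \<Longrightarrow> r \<in> extensional {..<d}"
  by (simp add: cube_cells_def PiE_iff)

lemma row_neg_cube_cells:
  assumes "r \<in> cube_cells d N n"
  shows "row_neg d r \<in> cube_cells d N n"
  unfolding cube_cells_def
proof (rule PiE_I)
  fix j assume "j \<in> {..<d}"
  then show "row_neg d r j \<in> (if j < n then odds (- N) N else {0})"
    using PiE_mem[OF assms[unfolded cube_cells_def], of j] by (auto simp: row_neg_def odds_def)
qed (simp add: row_neg_def)

lemma sum_cube_cells_neg: "(\<Sum>r\<in>cube_cells d N n. f (row_neg d r)) = (\<Sum>r\<in>cube_cells d N n. f r)"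
  by (rule sum.reindex_bij_witness[of _ "row_neg d" "row_neg d"])
    (auto simp: row_neg_row_neg cube_cells_extensional row_neg_cube_cells)

text \<open>Coordinate \<open>n\<close> of a top cell is odd, hence nonzero, so no cell lies on the
  equator and the antipodal map swaps the two halves.\<close>

lemma cube_cells_Suc:
  assumes "n < d" "even N"
  shows "(\<Sum>r\<in>cube_cells d N (Suc n). f r)
      = (\<Sum>r\<in>PiE {..<d} (half_box N (Suc n)). f r + f (row_neg d r))"
proof -
  let ?E = "PiE {..<d} (half_box N (Suc n))"
  have ext: "r \<in> extensional {..<d}" if "r \<in> ?E" for r
    using that by (simp add: PiE_iff)
  have nz: "r n > 0" if "r \<in> ?E" for r
    using PiE_mem[OF that, of n] assms(1) by (auto simp: half_box_def odds_def)
  have E: "?E = {r \<in> cube_cells d N (Suc n). r n > 0}"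
  proof (intro equalityI subsetI)
    fix r assume r: "r \<in> ?E"
    have "r \<in> cube_cells d N (Suc n)"
      unfolding cube_cells_def
    proof (rule PiE_I)
      fix j assume "j \<in> {..<d}"
      then show "r j \<in> (if j < Suc n then odds (- N) N else {0})"
        using PiE_mem[OF r, of j] nz[OF r] by (auto simp: half_box_def odds_def split: if_splits)
    qed (use r in \<open>auto simp: PiE_iff extensional_def\<close>)
    then show "r \<in> {r \<in> cube_cells d N (Suc n). r n > 0}" using nz[OF r] by simp
  next
    fix r assume r: "r \<in> {r \<in> cube_cells d N (Suc n). r n > 0}"
    show "r \<in> ?E"
    proof (rule PiE_I)
      fix j assume "j \<in> {..<d}"
      then show "r j \<in> half_box N (Suc n) j"
        using r PiE_mem[of r "{..<d}" "\<lambda>j. if j < Suc n then odds (- N) N else {0}" j]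
        by (auto simp: half_box_def odds_def cube_cells_def split: if_splits)
    qed (use r in \<open>auto simp: cube_cells_def PiE_iff extensional_def\<close>)
  qed
  have pos_neg: "r n > 0 \<or> r n < 0" if "r \<in> cube_cells d N (Suc n)" for r
    using PiE_mem[OF that[unfolded cube_cells_def], of n] assms(1)
    by (cases "r n = 0") (auto simp: odds_def)
  have flip: "row_neg d r n = - r n" for r using assms(1) by (simp add: row_neg_def)
  have neg: "row_neg d ` ?E = {r \<in> cube_cells d N (Suc n). r n < 0}"
  proof (intro equalityI subsetI)
    fix x assume "x \<in> row_neg d ` ?E"
    then obtain r where r: "x = row_neg d r" "r \<in> ?E" by blast
    then have "r \<in> cube_cells d N (Suc n)" "r n > 0" by (simp_all only: E mem_Collect_eq)
    then show "x \<in> {r \<in> cube_cells d N (Suc n). r n < 0}"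
      by (simp add: r(1) flip row_neg_cube_cells)
  next
    fix r assume r: "r \<in> {r \<in> cube_cells d N (Suc n). r n < 0}"
    then have "row_neg d r \<in> ?E"
      unfolding E by (simp add: flip row_neg_cube_cells)
    moreover have "row_neg d (row_neg d r) = r"
      using r by (metis (lifting) mem_Collect_eq row_neg_row_neg cube_cells_extensional)
    ultimately show "r \<in> row_neg d ` ?E" by (metis image_eqI)
  qed
  have inj: "inj_on (row_neg d) ?E"
    by (rule inj_onI) (metis ext row_neg_row_neg)
  have "cube_cells d N (Suc n) = ?E \<union> row_neg d ` ?E"
    unfolding neg unfolding E using pos_neg by blast
  moreover have "?E \<inter> row_neg d ` ?E = {}" unfolding neg unfolding E by auto
  moreover have "finite ?E" by (auto intro!: finite_PiE)
  ultimately show ?thesis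
    by (simp add: sum.union_disjoint sum.reindex[OF inj] sum.distrib del: Un_insert_left)
qed

text \<open>The boundary of a hemisphere is its equator, the next smaller hemisphere plus its
  antipode. Stokes for \<open>cobd d f\<close> together with \<open>cobd_cobd\<close> flattens the
  hemisphere to a disc. The disc is a half box plus its antipode, so Stokes applies again to
  \<open>h\<close>; the flat disc left over is its own antipode, so it cancels.\<close>

lemma sum_hemi_Suc_cobd:
  assumes "Suc n < d" "even N" "N > 0"
  shows "(\<Sum>r\<in>hemi d N (Suc n). cobd d f r) = (\<Sum>r\<in>hemi d N n. f r + f (row_neg d r))"
proof -
  define h where "h = (\<lambda>r. f r + f (row_neg d r))"
  have "(\<Sum>r\<in>hemi d N (Suc n). cobd d f r) + (\<Sum>r\<in>cube_cells d N (Suc n). cobd d f r) = 0"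
    using sum_half_box_cobd[OF assms, of "cobd d f"] by (simp add: cobd_cobd)
  then have "(\<Sum>r\<in>hemi d N (Suc n). cobd d f r) = (\<Sum>r\<in>cube_cells d N (Suc n). cobd d f r)"
    by (metis add.assoc add_0 bit_double)
  also have "\<dots> = (\<Sum>r\<in>PiE {..<d} (half_box N (Suc n)). cobd d h r)"
    using assms by (simp add: cube_cells_Suc h_def cobd_add cobd_row_neg)
  also have "\<dots> = (\<Sum>r\<in>hemi d N n. h r) + (\<Sum>r\<in>cube_cells d N n. h r)"
    using assms by (intro sum_half_box_cobd) auto
  also have "(\<Sum>r\<in>cube_cells d N n. h r) = 0"
    by (simp add: h_def sum.distrib sum_cube_cells_neg)
  finally show ?thesis by (simp add: h_def)
qed

lemma hemi_0: "d > 0 \<Longrightarrow> hemi d N 0 = {\<lambda>j\<in>{..<d}. if j = 0 then N else 0}"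
proof -
  assume "d > 0"
  have "hemi d N 0 = PiE {..<d} (\<lambda>j. {if j = 0 then N else 0})"
    unfolding hemi_def hemi_face_def
    by simp (rule PiE_cong, auto simp: half_box_def)
  also have "\<dots> = {\<lambda>j\<in>{..<d}. if j = 0 then N else 0}"
  proof -
    let ?r = "\<lambda>j\<in>{..<d}. if j = 0 then N else 0"
    have "PiE {..<d} (\<lambda>j. {if j = 0 then N else 0}) = PiE {..<d} (\<lambda>j. {?r j})"
      by (rule PiE_cong) simp
    also have "\<dots> = {?r}" by (rule PiE_singleton) (rule restrict_extensional)
    finally show ?thesis .
  qed
  finally show ?thesis .
qed

lemma sum_hemi_0_cobd:
  assumes "d > 0" "even N"
  shows "(\<Sum>r\<in>hemi d N 0. cobd d f r) = 0"
  using assms by (auto simp: hemi_0 cobd_def edge_diff_def intro!: sum.neutral)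

section \<open>Sign cochains on products of spheres\<close>

definition flip_row :: "nat \<Rightarrow> nat \<Rightarrow> (nat \<Rightarrow> nat \<Rightarrow> int) \<Rightarrow> nat \<Rightarrow> nat \<Rightarrow> int" where
  "flip_row d i y = y(i := row_neg d (y i))"

definition row_cobd :: "nat \<Rightarrow> nat \<Rightarrow> ((nat \<Rightarrow> nat \<Rightarrow> int) \<Rightarrow> bit) \<Rightarrow> (nat \<Rightarrow> nat \<Rightarrow> int) \<Rightarrow> bit" where
  "row_cobd d i g y = cobd d (\<lambda>r. g (y(i := r))) (y i)"

definition pcobd :: "nat \<Rightarrow> nat \<Rightarrow> ((nat \<Rightarrow> nat \<Rightarrow> int) \<Rightarrow> bit) \<Rightarrow> (nat \<Rightarrow> nat \<Rightarrow> int) \<Rightarrow> bit" where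
  "pcobd k d g y = (\<Sum>i<k. row_cobd d i g y)"

definition facets :: "nat \<Rightarrow> nat \<Rightarrow> (nat \<Rightarrow> nat \<Rightarrow> int) \<Rightarrow> (nat \<Rightarrow> nat \<Rightarrow> int) set" where
  "facets k d y = {y(i := (y i)(j := y i j + e)) | i j e. i < k \<and> j < d \<and> odd (y i j) \<and> e \<in> {1, -1}}"

lemma facets_upd:
  assumes "i < k" "j < d" "odd (y i j)"
  shows "y(i := (y i)(j := y i j + 1)) \<in> facets k d y" "y(i := (y i)(j := y i j - 1)) \<in> facets k d y"
proof -
  show "y(i := (y i)(j := y i j + 1)) \<in> facets k d y"
    unfolding facets_def using assms by blast
  have "y(i := (y i)(j := y i j + (-1))) \<in> facets k d y"
    unfolding facets_def using assms by blast
  then show "y(i := (y i)(j := y i j - 1)) \<in> facets k d y" by simp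
qed

lemma pcobd_cong:
  assumes "\<And>x. x \<in> facets k d y \<Longrightarrow> f x = g x"
  shows "pcobd k d f y = pcobd k d g y"
  unfolding pcobd_def row_cobd_def cobd_def edge_diff_def
  by (intro sum.cong refl) (simp add: assms facets_upd)

lemma pcobd_eq_0:
  assumes "\<And>x. x \<in> facets k d y \<Longrightarrow> f x = 0"
  shows "pcobd k d f y = 0"
proof -
  have "pcobd k d f y = pcobd k d (\<lambda>x. 0) y" by (rule pcobd_cong) (simp add: assms)
  also have "\<dots> = 0" by (simp add: pcobd_def row_cobd_def)
  finally show ?thesis .
qed

lemma pcobd_add: "pcobd k d (\<lambda>x. f x + g x) y = pcobd k d f y + pcobd k d g y"
  by (simp add: pcobd_def row_cobd_def cobd_add sum.distrib)

lemma pcobd_mult: "pcobd k d (\<lambda>x. f x * a) y = pcobd k d f y * a"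
  by (cases a) (simp_all add: pcobd_eq_0)

lemma cobd_swap:
  "cobd d (\<lambda>r. cobd d (\<lambda>s. h r s) b) a = cobd d (\<lambda>s. cobd d (\<lambda>r. h r s) a) b"
proof -
  have "cobd d (\<lambda>r. cobd d (\<lambda>s. h r s) b) a = (\<Sum>i<d. \<Sum>j<d. edge_diff i (\<lambda>r. edge_diff j (\<lambda>s. h r s) b) a)"
    by (simp add: cobd_def edge_diff_sum)
  also have "\<dots> = (\<Sum>i<d. \<Sum>j<d. edge_diff j (\<lambda>s. edge_diff i (\<lambda>r. h r s) a) b)"
    by (intro sum.cong refl) (auto simp: edge_diff_def ac_simps)
  also have "\<dots> = (\<Sum>j<d. \<Sum>i<d. edge_diff j (\<lambda>s. edge_diff i (\<lambda>r. h r s) a) b)"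
    by (rule sum.swap)
  also have "\<dots> = cobd d (\<lambda>s. cobd d (\<lambda>r. h r s) a) b"
    by (simp add: cobd_def edge_diff_sum)
  finally show ?thesis .
qed

lemma row_cobd_self: "row_cobd d i (row_cobd d i g) y = 0"
proof -
  have "row_cobd d i (row_cobd d i g) y = cobd d (cobd d (\<lambda>s. g (y(i := s)))) (y i)"
    by (simp add: row_cobd_def)
  then show ?thesis by (simp add: cobd_cobd)
qed

lemma row_cobd_commute: "row_cobd d i (row_cobd d j g) y = row_cobd d j (row_cobd d i g) y"
proof (cases "i = j")
  case False
  have "row_cobd d i (row_cobd d j g) y = cobd d (\<lambda>r. cobd d (\<lambda>s. g (y(i := r, j := s))) (y j)) (y i)"
    using False by (simp add: row_cobd_def)
  also have "\<dots> = cobd d (\<lambda>s. cobd d (\<lambda>r. g (y(j := s, i := r))) (y i)) (y j)"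
    using False by (subst cobd_swap) (simp add: fun_upd_twist)
  also have "\<dots> = row_cobd d j (row_cobd d i g) y"
    using False by (simp add: row_cobd_def)
  finally show ?thesis .
qed simp

lemma row_cobd_sum: "row_cobd d i (\<lambda>y. \<Sum>x\<in>A. f x y) y = (\<Sum>x\<in>A. row_cobd d i (f x) y)"
proof -
  have "cobd d (\<lambda>r. \<Sum>x\<in>A. f x (y(i := r))) (y i) = (\<Sum>j<d. \<Sum>x\<in>A. edge_diff j (\<lambda>r. f x (y(i := r))) (y i))"
    by (simp add: cobd_def edge_diff_sum)
  then show ?thesis
    unfolding row_cobd_def cobd_def by (simp add: sum.swap[of _ A])
qed

lemma pcobd_pcobd: "pcobd k d (pcobd k d g) y = 0"
proof -
  have "pcobd k d (pcobd k d g) y = (\<Sum>i<k. \<Sum>j<k. row_cobd d i (row_cobd d j g) y)"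
    unfolding pcobd_def[abs_def] by (simp add: row_cobd_sum)
  also have "\<dots> = 0"
    by (rule sum_bit_symmetric_zero) (simp_all add: row_cobd_self row_cobd_commute)
  finally show ?thesis .
qed

lemma pcobd_flip_row: "pcobd k d (\<lambda>y. g (flip_row d i y)) y = pcobd k d g (flip_row d i y)"
proof -
  have "row_cobd d l (\<lambda>y. g (flip_row d i y)) y = row_cobd d l g (flip_row d i y)" for l
  proof (cases "l = i")
    case True
    have "row_cobd d i (\<lambda>y. g (flip_row d i y)) y = cobd d (\<lambda>r. g (y(i := row_neg d r))) (y i)"
      by (simp add: row_cobd_def flip_row_def)
    also have "\<dots> = row_cobd d i g (flip_row d i y)"
      by (simp add: cobd_row_neg[where f = "\<lambda>r. g (y(i := r))"] row_cobd_def flip_row_def)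
    finally show ?thesis using True by simp
  next
    case False
    then show ?thesis by (simp add: row_cobd_def flip_row_def fun_upd_twist)
  qed
  then show ?thesis by (simp add: pcobd_def)
qed

text \<open>With \<open>u c\<close> the sign bits of a real function \<open>F c\<close>, this is the cup product of the coboundaries of
  the \<open>u c\<close>: it counts the flags of cells along which every \<open>F c\<close> changes sign at its own step.\<close>

fun sign_cochain :: "nat \<Rightarrow> nat \<Rightarrow> ('c \<Rightarrow> (nat \<Rightarrow> nat \<Rightarrow> int) \<Rightarrow> bit) \<Rightarrow> 'c list \<Rightarrow> (nat \<Rightarrow> nat \<Rightarrow> int) \<Rightarrow> bit" where
  "sign_cochain k d u [] y = 1"
| "sign_cochain k d u (c # cs) y = pcobd k d (\<lambda>x. sign_cochain k d u cs x * u c x) y"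

lemma pcobd_sign_cochain: "pcobd k d (sign_cochain k d u cs) y = 0"
proof (cases cs)
  case Nil
  then have "sign_cochain k d u cs = (\<lambda>x. 1)" by (simp add: fun_eq_iff)
  then show ?thesis
    by (auto simp: pcobd_def row_cobd_def cobd_def edge_diff_def intro!: sum.neutral)
next
  case (Cons c cs')
  then have "sign_cochain k d u cs = pcobd k d (\<lambda>x. sign_cochain k d u cs' x * u c x)"
    by (simp add: fun_eq_iff)
  then show ?thesis by (simp add: pcobd_pcobd)
qed

section \<open>Invariance, localization and evaluation of the sign cochains\<close>

definition sphere_rows :: "nat \<Rightarrow> int \<Rightarrow> (nat \<Rightarrow> int) set" where
  "sphere_rows d N = {r \<in> extensional {..<d}. (\<forall>j<d. \<bar>r j\<bar> \<le> N) \<and> (\<exists>j<d. \<bar>r j\<bar> = N)}"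

definition sphere_cells :: "nat \<Rightarrow> nat \<Rightarrow> int \<Rightarrow> (nat \<Rightarrow> nat \<Rightarrow> int) set" where
  "sphere_cells k d N = PiE {..<k} (\<lambda>_. sphere_rows d N)"

text \<open>Passing to a face moves only an odd coordinate, whereas a coordinate of absolute value
  \<open>N\<close> is even and stays.\<close>

lemma facets_sphere_cells:
  assumes "y \<in> sphere_cells k d N" "even N" "x \<in> facets k d y"
  shows "x \<in> sphere_cells k d N"
proof -
  obtain i j e where x: "x = y(i := (y i)(j := y i j + e))" "i < k" "j < d" "odd (y i j)" "e = 1 \<or> e = -1"
    using assms(3) by (auto simp: facets_def)
  have y: "y i \<in> sphere_rows d N" "y \<in> extensional {..<k}" "\<And>l. l < k \<Longrightarrow> y l \<in> sphere_rows d N"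
    using assms(1) x(2) by (auto simp: sphere_cells_def PiE_iff)
  obtain l where l: "l < d" "\<bar>y i l\<bar> = N" using y(1) by (auto simp: sphere_rows_def)
  have "\<bar>y i j\<bar> \<noteq> N" using x(4) assms(2) by auto
  moreover have "\<bar>y i j\<bar> \<le> N" using y(1) x(3) by (auto simp: sphere_rows_def)
  ultimately have "\<bar>y i j + e\<bar> \<le> N" using x(5) by linarith
  moreover have "l \<noteq> j" using l \<open>\<bar>y i j\<bar> \<noteq> N\<close> by auto
  ultimately have "(y i)(j := y i j + e) \<in> sphere_rows d N"
    using y(1) l x(3) by (auto simp: sphere_rows_def extensional_def)
  then show ?thesis
    using y(2,3) x(2) by (auto simp: x(1) sphere_cells_def PiE_iff extensional_def)
qed

text \<open>A flip changes \<open>u c\<close> by a constant bit only, so the product under the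
  coboundary changes by a constant multiple of a cocycle, which contributes nothing.\<close>

lemma sign_cochain_flip_row:
  assumes "even N" "i < k"
    and u: "\<And>c y. c \<in> set cs \<Longrightarrow> y \<in> sphere_cells k d N \<Longrightarrow> u c (flip_row d i y) = u c y + of_bool (i \<in> \<sigma> c)"
    and "y \<in> sphere_cells k d N"
  shows "sign_cochain k d u cs (flip_row d i y) = sign_cochain k d u cs y"
  using u assms(4)
proof (induction cs arbitrary: y)
  case (Cons c cs)
  let ?h = "\<lambda>x. sign_cochain k d u cs x * u c x"
  have "sign_cochain k d u (c # cs) (flip_row d i y) = pcobd k d (\<lambda>x. ?h (flip_row d i x)) y"
    by (subst pcobd_flip_row) simp
  also have "\<dots> = pcobd k d (\<lambda>x. ?h x + sign_cochain k d u cs x * of_bool (i \<in> \<sigma> c)) y"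
  proof (rule pcobd_cong)
    fix x assume "x \<in> facets k d y"
    then have x: "x \<in> sphere_cells k d N" using Cons.prems assms(1) facets_sphere_cells by blast
    have "sign_cochain k d u cs (flip_row d i x) = sign_cochain k d u cs x"
      by (rule Cons.IH) (use Cons.prems x in auto)
    moreover have "u c (flip_row d i x) = u c x + of_bool (i \<in> \<sigma> c)"
      by (rule Cons.prems) (use x in auto)
    ultimately show "?h (flip_row d i x) = ?h x + sign_cochain k d u cs x * of_bool (i \<in> \<sigma> c)"
      by (simp add: distrib_left)
  qed
  also have "\<dots> = sign_cochain k d u (c # cs) y"
    by (simp only: pcobd_add pcobd_mult pcobd_sign_cochain) simp
  finally show ?case .
qed simp

text \<open>By the cocycle property, \<open>u b x\<close> may be replaced by
  \<open>u b x + u b y\<close> under the coboundary. A nonzero value thus yields a facet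
  \<open>x\<close> with \<open>u b x \<noteq> u b y\<close> on which the shorter cochain is still
  nonzero. Each descent moves coordinates by at most 1, whence the bound
  \<open>length cs\<close>.\<close>

lemma sign_cochain_nonzero:
  assumes "even N" "y \<in> sphere_cells k d N" "sign_cochain k d u cs y \<noteq> 0" "c \<in> set cs"
  shows "\<exists>x\<in>sphere_cells k d N. \<exists>x'\<in>sphere_cells k d N. u c x \<noteq> u c x' \<and>
    (\<forall>i<k. \<forall>j<d. \<bar>x i j - y i j\<bar> \<le> int (length cs) \<and> \<bar>x' i j - y i j\<bar> \<le> int (length cs))"
  using assms(2-4)
proof (induction cs arbitrary: y)
  case (Cons b cs)
  let ?h = "\<lambda>x. sign_cochain k d u cs x * u b x"
  have "pcobd k d (\<lambda>x. ?h x + sign_cochain k d u cs x * u b y) y = sign_cochain k d u (b # cs) y"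
    by (simp only: pcobd_add pcobd_mult pcobd_sign_cochain) simp
  then have "pcobd k d (\<lambda>x. ?h x + sign_cochain k d u cs x * u b y) y \<noteq> 0"
    using Cons.prems(2) by (simp only: not_False_eq_True)
  then obtain x where x: "x \<in> facets k d y" "?h x + sign_cochain k d u cs x * u b y \<noteq> 0"
    using pcobd_eq_0[of k d y "\<lambda>x. ?h x + sign_cochain k d u cs x * u b y"] by blast
  then have ne: "sign_cochain k d u cs x \<noteq> 0" "u b x \<noteq> u b y"
    by (auto simp flip: distrib_left)
  have xs: "x \<in> sphere_cells k d N"
    using facets_sphere_cells Cons.prems(1) assms(1) x(1) by blast
  have near: "\<bar>x i j - y i j\<bar> \<le> 1" for i j
    using x(1) by (auto simp: facets_def)
  show ?case
  proof (cases "c = b")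
    case True
    have "\<bar>x i j - y i j\<bar> \<le> int (length (b # cs))" for i j
      using near[of i j] by simp
    then show ?thesis using ne(2) xs Cons.prems(1) True by fastforce
  next
    case False
    then obtain z z' where z: "z \<in> sphere_cells k d N" "z' \<in> sphere_cells k d N" "u c z \<noteq> u c z'"
      "\<And>i j. i < k \<Longrightarrow> j < d \<Longrightarrow> \<bar>z i j - x i j\<bar> \<le> int (length cs) \<and> \<bar>z' i j - x i j\<bar> \<le> int (length cs)"
      using Cons.IH[OF xs ne(1)] Cons.prems(3) by auto
    have "\<bar>z i j - y i j\<bar> \<le> int (length (b # cs)) \<and> \<bar>z' i j - y i j\<bar> \<le> int (length (b # cs))"
      if "i < k" "j < d" for i j
      using z(4)[OF that] near[of i j] by auto
    then show ?thesis using z(1-3) by blast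
  qed
qed simp

definition hemi_cells :: "nat \<Rightarrow> nat \<Rightarrow> int \<Rightarrow> (nat \<Rightarrow> nat) \<Rightarrow> (nat \<Rightarrow> nat \<Rightarrow> int) set" where
  "hemi_cells k d N n = PiE {..<k} (\<lambda>i. hemi d N (n i))"

lemma hemi_sphere_rows:
  assumes "n < d" "N > 0" "r \<in> hemi d N n"
  shows "r \<in> sphere_rows d N"
proof -
  obtain j where j: "j \<le> n" "r \<in> hemi_face d N n j" using assms(3) by (auto simp: hemi_def)
  note r = j(2)[unfolded hemi_face_def]
  have "\<bar>r l\<bar> \<le> N" if "l < d" for l
    using PiE_mem[OF r, of l] that assms(2) by (auto simp: half_box_def odds_def split: if_splits)
  moreover have "\<bar>r j\<bar> = N"
    using PiE_mem[OF r, of j] j(1) assms by (auto split: if_splits)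
  moreover have "j < d" using j(1) assms(1) by simp
  ultimately show ?thesis
    using r unfolding sphere_rows_def PiE_iff by blast
qed

lemma hemi_cells_subset:
  assumes "\<And>i. i < k \<Longrightarrow> n i < d" "N > 0"
  shows "hemi_cells k d N n \<subseteq> sphere_cells k d N"
  unfolding hemi_cells_def sphere_cells_def
  by (rule PiE_mono) (use assms hemi_sphere_rows in blast)

lemma sum_hemi_cells_row_cobd:
  assumes "i < k" "n i < d" "even N" "N > 0"
  shows "(\<Sum>y\<in>hemi_cells k d N n. row_cobd d i g y)
    = (if n i = 0 then 0 else \<Sum>y\<in>hemi_cells k d N (n(i := n i - 1)). g y + g (flip_row d i y))"
proof -
  have i: "i \<in> {..<k}" using assms(1) by simp
  have split: "(\<Sum>y\<in>hemi_cells k d N m. f y)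
    = (\<Sum>h\<in>PiE ({..<k} - {i}) (\<lambda>l. hemi d N (n l)). \<Sum>r\<in>hemi d N (m i). f (h(i := r)))"
    if "\<And>l. l \<noteq> i \<Longrightarrow> m l = n l" for m and f :: "_ \<Rightarrow> bit"
  proof -
    have "PiE ({..<k} - {i}) (\<lambda>l. hemi d N (m l)) = PiE ({..<k} - {i}) (\<lambda>l. hemi d N (n l))"
      by (rule PiE_cong) (use that in auto)
    then show ?thesis unfolding hemi_cells_def sum_PiE_remove[OF i] by simp
  qed
  have inner: "(\<Sum>r\<in>hemi d N (n i). row_cobd d i g (h(i := r)))
      = (\<Sum>r\<in>hemi d N (n i). cobd d (\<lambda>s. g (h(i := s))) r)" for h
    by (simp add: row_cobd_def)
  show ?thesis
  proof (cases "n i")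
    case 0
    then show ?thesis
      using assms sum_hemi_0_cobd[of d N] by (simp add: split[of n] inner[unfolded 0])
  next
    case (Suc q)
    have "(\<Sum>y\<in>hemi_cells k d N n. row_cobd d i g y)
      = (\<Sum>h\<in>PiE ({..<k} - {i}) (\<lambda>l. hemi d N (n l)). \<Sum>r\<in>hemi d N q. g (h(i := r)) + g (h(i := row_neg d r)))"
      using assms Suc sum_hemi_Suc_cobd[of q d N] by (simp add: split[of n] inner[unfolded Suc])
    also have "\<dots> = (\<Sum>y\<in>hemi_cells k d N (n(i := n i - 1)). g y + g (flip_row d i y))"
      by (subst split) (simp_all add: Suc flip_row_def)
    finally show ?thesis using Suc by simp
  qed
qed

text \<open>In the mod 2 cohomology ring of the product of the projective spaces of dimensions \<open>n i\<close>, it means that the product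
  of the classes \<open>\<Sum>i\<in>\<sigma> c. x i\<close> is the monomial \<open>\<Prod>i. x i ^ n i\<close>, and for a simple reason: each factor
  contributes the single variable \<open>x (\<iota> c)\<close>, the other variables being already used up.\<close>

fun admissible :: "nat \<Rightarrow> ('c \<Rightarrow> nat set) \<Rightarrow> ('c \<Rightarrow> nat) \<Rightarrow> 'c list \<Rightarrow> (nat \<Rightarrow> nat) \<Rightarrow> bool" where
  "admissible k \<sigma> \<iota> [] n \<longleftrightarrow> (\<forall>i<k. n i = 0)"
| "admissible k \<sigma> \<iota> (c # cs) n \<longleftrightarrow> \<iota> c < k \<and> \<iota> c \<in> \<sigma> c \<and> n (\<iota> c) > 0 \<and>
    (\<forall>i<k. i \<in> \<sigma> c \<and> i \<noteq> \<iota> c \<longrightarrow> n i = 0) \<and> admissible k \<sigma> \<iota> cs (n(\<iota> c := n (\<iota> c) - 1))"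

text \<open>Stokes in row \<open>i\<close> replaces the hemisphere of that row by its equator. As
  the cochain of \<open>cs\<close> is flip invariant, the two halves of the equator add up to
  \<open>of_bool (i \<in> \<sigma> c)\<close> times that cochain on the smaller hemisphere. Rows
  with \<open>n i = 0\<close> give nothing, so admissibility leaves only the row
  \<open>\<iota> c\<close>.\<close>

lemma sum_sign_cochain:
  assumes "d > 0" "even N" "N > 0"
    and u: "\<And>c i y. c \<in> set cs \<Longrightarrow> i < k \<Longrightarrow> y \<in> sphere_cells k d N \<Longrightarrow>
      u c (flip_row d i y) = u c y + of_bool (i \<in> \<sigma> c)"
    and "admissible k \<sigma> \<iota> cs n" "\<And>i. i < k \<Longrightarrow> n i < d"
  shows "(\<Sum>y\<in>hemi_cells k d N n. sign_cochain k d u cs y) = 1"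
  using u assms(5,6)
proof (induction cs arbitrary: n)
  case Nil
  have "hemi_cells k d N n = PiE {..<k} (\<lambda>i. {(\<lambda>i\<in>{..<k}. \<lambda>j\<in>{..<d}. if j = 0 then N else 0) i})"
    unfolding hemi_cells_def by (rule PiE_cong) (use Nil.prems assms(1) in \<open>simp add: hemi_0\<close>)
  also have "\<dots> = {\<lambda>i\<in>{..<k}. \<lambda>j\<in>{..<d}. if j = 0 then N else 0}"
    by (rule PiE_singleton) (rule restrict_extensional)
  finally show ?case by simp
next
  case (Cons c cs)
  let ?h = "\<lambda>x. sign_cochain k d u cs x * u c x"
  let ?T = "\<lambda>i. \<Sum>y\<in>hemi_cells k d N (n(i := n i - 1)). sign_cochain k d u cs y"
  have lt: "n l < d" if "l < k" for l using Cons.prems(3) that by blast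
  have T: "(\<Sum>y\<in>hemi_cells k d N n. row_cobd d i ?h y) = of_bool (i = \<iota> c) * ?T i" if i: "i < k" for i
  proof (cases "n i = 0")
    case True
    then show ?thesis
      using Cons.prems(2) i lt assms by (auto simp: sum_hemi_cells_row_cobd)
  next
    case False
    have "?h y + ?h (flip_row d i y) = of_bool (i \<in> \<sigma> c) * sign_cochain k d u cs y"
      if "y \<in> hemi_cells k d N (n(i := n i - 1))" for y
    proof -
      have "hemi_cells k d N (n(i := n i - 1)) \<subseteq> sphere_cells k d N"
        by (rule hemi_cells_subset) (use lt less_imp_diff_less assms(3) in auto)
      then have y: "y \<in> sphere_cells k d N" using that by blast
      have "sign_cochain k d u cs (flip_row d i y) = sign_cochain k d u cs y"
        by (rule sign_cochain_flip_row[where N = N and \<sigma> = \<sigma>]) (use Cons.prems(1) i y assms in auto)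
      moreover have "u c (flip_row d i y) = u c y + of_bool (i \<in> \<sigma> c)"
        by (rule Cons.prems(1)) (use i y in auto)
      ultimately have "?h y + ?h (flip_row d i y)
          = (?h y + ?h y) + of_bool (i \<in> \<sigma> c) * sign_cochain k d u cs y"
        by (simp only: distrib_left add.assoc mult.commute)
      then show ?thesis by simp
    qed
    then have "(\<Sum>y\<in>hemi_cells k d N n. row_cobd d i ?h y) = of_bool (i \<in> \<sigma> c) * ?T i"
      using False i lt assms by (simp add: sum_hemi_cells_row_cobd sum_distrib_left)
    moreover have "i \<in> \<sigma> c \<longleftrightarrow> i = \<iota> c" using Cons.prems(2) i False by auto
    ultimately show ?thesis by simp
  qed
  have "(\<Sum>y\<in>hemi_cells k d N n. sign_cochain k d u (c # cs) y)
      = (\<Sum>i<k. \<Sum>y\<in>hemi_cells k d N n. row_cobd d i ?h y)"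
    by (simp add: pcobd_def) (rule sum.swap)
  also have "\<dots> = (\<Sum>i<k. if i = \<iota> c then ?T i else 0)"
    by (rule sum.cong) (simp_all add: T)
  also have "\<dots> = ?T (\<iota> c)" using Cons.prems(2) by (simp add: sum.delta)
  also have "\<dots> = 1"
  proof (rule Cons.IH)
    show "admissible k \<sigma> \<iota> cs (n(\<iota> c := n (\<iota> c) - 1))" using Cons.prems(2) by simp
  qed (use Cons.prems(1) lt less_imp_diff_less in auto)
  finally show ?case .
qed

section \<open>The Borsuk-Ulam theorem for products of spheres\<close>

lemma tendsto_fun_iff:
  fixes x :: "nat \<Rightarrow> 'i \<Rightarrow> 'a::topological_space"
  shows "(x \<longlonglongrightarrow> a) \<longleftrightarrow> (\<forall>i. (\<lambda>n. x n i) \<longlonglongrightarrow> a i)"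
proof -
  have "(x \<longlonglongrightarrow> a) \<longleftrightarrow> limitin (product_topology (\<lambda>_. euclidean) UNIV) x a sequentially"
    by (simp only: euclidean_product_topology limitin_canonical_iff)
  also have "\<dots> \<longleftrightarrow> (\<forall>i. (\<lambda>n. x n i) \<longlonglongrightarrow> a i)"
    by (simp add: limitin_componentwise limitin_canonical_iff)
  finally show ?thesis .
qed

text \<open>Off \<open>I\<close> the functions are pinned to \<open>undefined\<close>, so the set is
  a full product with singleton factors there and Tychonoff's theorem applies.\<close>

lemma compact_PiE_fun:
  fixes S :: "'i \<Rightarrow> 'a::topological_space set"
  assumes "\<And>i. i \<in> I \<Longrightarrow> compact (S i)"
  shows "compact (PiE I S)"
proof -
  have "PiE I S = PiE UNIV (\<lambda>i. if i \<in> I then S i else {undefined})"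
  proof (intro equalityI subsetI)
    fix f assume "f \<in> PiE UNIV (\<lambda>i. if i \<in> I then S i else {undefined})"
    then have f: "f i \<in> (if i \<in> I then S i else {undefined})" for i
      using PiE_mem by fast
    then have "f i \<in> S i" if "i \<in> I" for i using f[of i] that by simp
    moreover have "f i = undefined" if "i \<notin> I" for i using f[of i] that by simp
    ultimately show "f \<in> PiE I S" by auto
  qed (auto simp: PiE_iff extensional_def)
  moreover have "compactin (product_topology (\<lambda>_. euclidean) UNIV) (PiE UNIV (\<lambda>i. if i \<in> I then S i else {undefined}))"
    using assms by (auto simp: compactin_PiE)
  ultimately show ?thesis
    by (simp add: euclidean_product_topology)
qed

lemma norm_sgn_diff_le:
  fixes x y :: "'a::real_normed_vector"
  assumes "x \<noteq> 0" "y \<noteq> 0"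
  shows "norm (sgn x - sgn y) \<le> 2 * norm (x - y) / norm x"
proof -
  have "sgn x - sgn y = (x - y) /\<^sub>R norm x + (1 / norm x - 1 / norm y) *\<^sub>R y"
    by (simp add: sgn_div_norm algebra_simps inverse_eq_divide)
  then have "norm (sgn x - sgn y) \<le> norm ((x - y) /\<^sub>R norm x) + norm ((1 / norm x - 1 / norm y) *\<^sub>R y)"
    by (metis norm_triangle_ineq)
  moreover have "norm ((x - y) /\<^sub>R norm x) = norm (x - y) / norm x"
    by (simp add: divide_inverse mult.commute)
  moreover have "norm ((1 / norm x - 1 / norm y) *\<^sub>R y) = \<bar>norm y - norm x\<bar> / norm x"
  proof -
    have "norm ((1 / norm x - 1 / norm y) *\<^sub>R y) = \<bar>(1 / norm x - 1 / norm y) * norm y\<bar>"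
      by (simp add: abs_mult)
    also have "(1 / norm x - 1 / norm y) * norm y = (norm y - norm x) / norm x"
      using assms by (simp add: field_simps)
    finally show ?thesis by simp
  qed
  moreover have "\<bar>norm y - norm x\<bar> / norm x \<le> norm (x - y) / norm x"
    by (rule divide_right_mono) (metis norm_minus_commute norm_triangle_ineq3, simp)
  ultimately show ?thesis by simp
qed

definition lattice_vec :: "(nat \<Rightarrow> 'a::euclidean_space) \<Rightarrow> (nat \<Rightarrow> int) \<Rightarrow> 'a" where
  "lattice_vec b r = (\<Sum>j<DIM('a). of_int (r j) *\<^sub>R b j)"

text \<open>The centre of each row's cell, pushed radially to the unit sphere. This commutes with
  antipodes, and bounded moves in the grid become moves of order \<open>1 / N\<close>.\<close>

definition lattice_point :: "nat \<Rightarrow> (nat \<Rightarrow> 'a::euclidean_space) \<Rightarrow> (nat \<Rightarrow> nat \<Rightarrow> int) \<Rightarrow> nat \<Rightarrow> 'a" where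
  "lattice_point k b y = (\<lambda>i\<in>{..<k}. sgn (lattice_vec b (y i)))"

text \<open>An antipodally odd sign on nonzero rows, taken from the first nonzero coordinate. It
  breaks ties where a function vanishes.\<close>

definition neg_row :: "nat \<Rightarrow> (nat \<Rightarrow> int) \<Rightarrow> bool" where
  "neg_row d r \<longleftrightarrow> r (LEAST j. j < d \<and> r j \<noteq> 0) < 0"

lemma neg_row_row_neg:
  assumes "j < d" "r j \<noteq> 0"
  shows "neg_row d (row_neg d r) \<longleftrightarrow> \<not> neg_row d r"
proof -
  have "(j < d \<and> row_neg d r j \<noteq> 0) = (j < d \<and> r j \<noteq> 0)" for j
    by (auto simp: row_neg_def)
  then have eq: "(LEAST j. j < d \<and> row_neg d r j \<noteq> 0) = (LEAST j. j < d \<and> r j \<noteq> 0)" by presburger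
  have "(LEAST j. j < d \<and> r j \<noteq> 0) < d \<and> r (LEAST j. j < d \<and> r j \<noteq> 0) \<noteq> 0"
    by (rule LeastI[of "\<lambda>j. j < d \<and> r j \<noteq> 0"]) (use assms in simp)
  then show ?thesis unfolding neg_row_def eq by (auto simp: row_neg_def)
qed

context
  fixes b :: "nat \<Rightarrow> 'a::euclidean_space"
  assumes b: "bij_betw b {..<DIM('a)} Basis"
begin

lemma enum_Basis: "j < DIM('a) \<Longrightarrow> b j \<in> Basis"
  using b by (auto simp: bij_betw_def)

lemma lattice_vec_inner:
  assumes "j < DIM('a)"
  shows "lattice_vec b r \<bullet> b j = of_int (r j)"
proof -
  have "b l \<bullet> b j = (if l = j then 1 else 0)" if "l < DIM('a)" for l
    using bij_betw_imp_inj_on[OF b] enum_Basis that assms by (auto simp: inj_on_eq_iff inner_Basis)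
  then have "lattice_vec b r \<bullet> b j = (\<Sum>l<DIM('a). if l = j then of_int (r l) else 0)"
    unfolding lattice_vec_def inner_sum_left by (intro sum.cong) auto
  then show ?thesis using assms by simp
qed

lemma norm_lattice_vec_ge:
  assumes "r \<in> sphere_rows DIM('a) N"
  shows "of_int N \<le> norm (lattice_vec b r)"
proof -
  obtain j where j: "j < DIM('a)" "\<bar>r j\<bar> = N" using assms by (auto simp: sphere_rows_def)
  have "\<bar>lattice_vec b r \<bullet> b j\<bar> \<le> norm (lattice_vec b r)"
    using enum_Basis[OF j(1)] by (rule Basis_le_norm)
  then show ?thesis using j by (simp add: lattice_vec_inner)
qed

lemma lattice_vec_row_neg: "lattice_vec b (row_neg DIM('a) r) = - lattice_vec b r"
  by (simp add: lattice_vec_def row_neg_def sum_negf)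

lemma norm_lattice_vec_diff:
  assumes "\<And>j. j < DIM('a) \<Longrightarrow> \<bar>r j - s j\<bar> \<le> l"
  shows "norm (lattice_vec b r - lattice_vec b s) \<le> real DIM('a) * of_int l"
proof -
  have "lattice_vec b r - lattice_vec b s = (\<Sum>j<DIM('a). of_int (r j - s j) *\<^sub>R b j)"
    by (simp add: lattice_vec_def sum_subtractf scaleR_diff_left)
  also have "norm \<dots> \<le> of_nat (card {..<DIM('a)}) * of_int l"
  proof (rule sum_norm_bound)
    fix j assume j: "j \<in> {..<DIM('a)}"
    then have "norm (b j) = 1" using enum_Basis by simp
    moreover have "\<bar>of_int (r j - s j)\<bar> \<le> (of_int l :: real)"
      using assms[of j] j by (metis lessThan_iff of_int_abs of_int_le_iff)
    ultimately show "norm (of_int (r j - s j) *\<^sub>R b j) \<le> of_int l" by simp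
  qed
  finally show ?thesis by simp
qed

lemma lattice_point_mem:
  assumes "y \<in> sphere_cells k DIM('a) N" "N > 0"
  shows "lattice_point k b y \<in> PiE {..<k} (\<lambda>_. sphere 0 1)"
proof -
  have "norm (sgn (lattice_vec b (y i))) = 1" if "i < k" for i
  proof -
    have "y i \<in> sphere_rows DIM('a) N" using assms that by (auto simp: sphere_cells_def)
    then have "lattice_vec b (y i) \<noteq> 0" using norm_lattice_vec_ge assms(2) by fastforce
    then show ?thesis by (simp add: norm_sgn)
  qed
  then show ?thesis by (auto simp: lattice_point_def)
qed

lemma lattice_point_flip_row:
  assumes "i < k"
  shows "lattice_point k b (flip_row DIM('a) i y) = (lattice_point k b y)(i := - lattice_point k b y i)"
  using assms by (auto simp: lattice_point_def flip_row_def lattice_vec_row_neg sgn_minus fun_eq_iff)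

lemma lattice_point_near:
  assumes "x \<in> sphere_cells k DIM('a) N" "y \<in> sphere_cells k DIM('a) N" "N > 0" "i < k"
    and "\<And>j. j < DIM('a) \<Longrightarrow> \<bar>x i j - y i j\<bar> \<le> l"
  shows "norm (lattice_point k b x i - lattice_point k b y i) \<le> 2 * (real DIM('a) * of_int l) / of_int N"
proof -
  have rows: "x i \<in> sphere_rows DIM('a) N" "y i \<in> sphere_rows DIM('a) N"
    using assms by (auto simp: sphere_cells_def)
  then have nz: "lattice_vec b (x i) \<noteq> 0" "lattice_vec b (y i) \<noteq> 0"
    using norm_lattice_vec_ge assms(3) by fastforce+
  have "norm (lattice_point k b x i - lattice_point k b y i)
      \<le> 2 * norm (lattice_vec b (x i) - lattice_vec b (y i)) / norm (lattice_vec b (x i))"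
    using assms(4) norm_sgn_diff_le[OF nz] by (simp add: lattice_point_def)
  also have "\<dots> \<le> 2 * (real DIM('a) * of_int l) / of_int N"
  proof -
    have le: "norm (lattice_vec b (x i) - lattice_vec b (y i)) \<le> real DIM('a) * of_int l"
      using norm_lattice_vec_diff assms(5) .
    then have "0 \<le> real DIM('a) * of_int l" by (rule order_trans[OF norm_ge_zero])
    with le show ?thesis
      by (intro frac_le) (use norm_lattice_vec_ge[OF rows(1)] assms(3) in auto)
  qed
  finally show ?thesis .
qed

lemma exists_small_sign_change:
  fixes F :: "'c \<Rightarrow> (nat \<Rightarrow> 'a) \<Rightarrow> real"
  assumes adm: "admissible k \<sigma> \<iota> cs n" "\<And>i. i < k \<Longrightarrow> n i < DIM('a)"
    and odd: "\<And>c i p. c \<in> set cs \<Longrightarrow> i < k \<Longrightarrow> p \<in> PiE {..<k} (\<lambda>_. sphere 0 1) \<Longrightarrow>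
      F c (p(i := - p i)) = (if i \<in> \<sigma> c then - F c p else F c p)"
    and "e > 0"
  shows "\<exists>p\<in>PiE {..<k} (\<lambda>_. sphere 0 1). \<forall>c\<in>set cs.
    \<exists>q\<in>PiE {..<k} (\<lambda>_. sphere 0 1). \<exists>q'\<in>PiE {..<k} (\<lambda>_. sphere 0 1).
      F c q * F c q' \<le> 0 \<and> (\<forall>i<k. norm (q i - p i) \<le> e \<and> norm (q' i - p i) \<le> e)"
proof -
  let ?d = "DIM('a)" let ?P = "lattice_point k b"
  \<comment> \<open>\<open>C / N\<close> is the bound of \<open>lattice_point_near\<close> for cells
    at grid distance \<open>length cs\<close>; \<open>M\<close> makes it at most
    \<open>e\<close>.\<close>
  define C where "C = 2 * (real ?d * of_int (int (length cs)))"
  obtain M :: nat where M: "C / e < real M" using reals_Archimedean2 by blast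
  define N where "N = 2 * int (Suc M)"
  have N: "even N" "N > 0" by (auto simp: N_def)
  have "C \<ge> 0" by (simp add: C_def)
  then have "C < e * real M" using M \<open>e > 0\<close> by (simp add: field_simps)
  also have "\<dots> \<le> e * of_int N" using \<open>e > 0\<close> by (simp add: N_def)
  finally have small: "C / of_int N \<le> e" using N(2) by (simp add: field_simps)
  \<comment> \<open>At a zero of \<open>F c\<close> there is no sign to record. The parity of the
    negative rows in \<open>\<sigma> c\<close> is used instead, so that \<open>u c\<close>
    transforms under flips in the same way everywhere.\<close>
  define u :: "'c \<Rightarrow> (nat \<Rightarrow> nat \<Rightarrow> int) \<Rightarrow> bit" where
    "u c y = (if F c (?P y) \<noteq> 0 then of_bool (F c (?P y) < 0)
      else (\<Sum>i<k. of_bool (i \<in> \<sigma> c \<and> neg_row ?d (y i))))" for c y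
  have u: "u c (flip_row ?d i y) = u c y + of_bool (i \<in> \<sigma> c)"
    if c: "c \<in> set cs" "i < k" and y: "y \<in> sphere_cells k ?d N" for c i y
  proof -
    have F: "F c (?P (flip_row ?d i y)) = (if i \<in> \<sigma> c then - F c (?P y) else F c (?P y))"
      using odd[OF c lattice_point_mem[OF y N(2)]] by (simp add: lattice_point_flip_row c(2))
    show ?thesis
    proof (cases "F c (?P y) = 0")
      case False
      then show ?thesis by (auto simp: u_def F)
    next
      case True
      have "y i \<in> sphere_rows ?d N" using y c(2) by (auto simp: sphere_cells_def)
      then obtain j where "j < ?d" "y i j \<noteq> 0" using N(2) by (auto simp: sphere_rows_def)
      then have neg: "neg_row ?d (row_neg ?d (y i)) \<longleftrightarrow> \<not> neg_row ?d (y i)"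
        by (rule neg_row_row_neg)
      have "(\<Sum>l<k. (of_bool (l \<in> \<sigma> c \<and> neg_row ?d (flip_row ?d i y l)) :: bit))
        = (\<Sum>l<k. of_bool (l \<in> \<sigma> c \<and> neg_row ?d (y l)) + (if l = i then of_bool (i \<in> \<sigma> c) else 0))"
        by (rule sum.cong) (auto simp: flip_row_def neg)
      then show ?thesis using True c(2) by (simp add: u_def F sum.distrib)
    qed
  qed
  have "(\<Sum>y\<in>hemi_cells k ?d N n. sign_cochain k ?d u cs y) = 1"
    by (rule sum_sign_cochain[where \<sigma> = \<sigma> and \<iota> = \<iota>]) (use N u adm in auto)
  then obtain y where y: "y \<in> hemi_cells k ?d N n" "sign_cochain k ?d u cs y \<noteq> 0"
    by (metis sum.neutral zero_neq_one)
  then have ys: "y \<in> sphere_cells k ?d N"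
    using hemi_cells_subset[of k n ?d N] adm(2) N(2) by blast
  show ?thesis
  proof (rule bexI[of _ "?P y"], rule ballI)
    show "?P y \<in> PiE {..<k} (\<lambda>_. sphere 0 1)" using lattice_point_mem[OF ys N(2)] .
    fix c assume "c \<in> set cs"
    then obtain x x' where x: "x \<in> sphere_cells k ?d N" "x' \<in> sphere_cells k ?d N" "u c x \<noteq> u c x'"
      and near: "\<forall>i<k. \<forall>j<?d. \<bar>x i j - y i j\<bar> \<le> int (length cs) \<and> \<bar>x' i j - y i j\<bar> \<le> int (length cs)"
      using sign_cochain_nonzero[OF N(1) ys y(2)] by blast
    \<comment> \<open>Different bits mean opposite strict signs, unless one of the two values is
      0.\<close>
    have "F c (?P x) * F c (?P x') \<le> 0"
      using x(3) by (auto simp: u_def mult_le_0_iff split: if_splits)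
    moreover have "norm (?P x i - ?P y i) \<le> e" "norm (?P x' i - ?P y i) \<le> e" if "i < k" for i
      using lattice_point_near[OF x(1) ys N(2) that, of "int (length cs)"]
        lattice_point_near[OF x(2) ys N(2) that, of "int (length cs)"] near that small
      by (auto simp: C_def)
    ultimately show "\<exists>q\<in>PiE {..<k} (\<lambda>_. sphere 0 1). \<exists>q'\<in>PiE {..<k} (\<lambda>_. sphere 0 1).
      F c q * F c q' \<le> 0 \<and> (\<forall>i<k. norm (q i - ?P y i) \<le> e \<and> norm (q' i - ?P y i) \<le> e)"
      using lattice_point_mem[OF x(1) N(2)] lattice_point_mem[OF x(2) N(2)] by blast
  qed
qed

end

text \<open>On finer grids the approximate zeros accumulate at some \<open>a\<close>. For each
  \<open>c\<close> the nearby pairs with product of values at most 0 also converge to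
  \<open>a\<close>, so the square of \<open>F c a\<close> is at most 0.\<close>

theorem borsuk_ulam_product_spheres:
  fixes F :: "'c \<Rightarrow> (nat \<Rightarrow> 'a::euclidean_space) \<Rightarrow> real"
  assumes adm: "admissible k \<sigma> \<iota> cs n" "\<And>i. i < k \<Longrightarrow> n i < DIM('a)"
    and cont: "\<And>c. c \<in> set cs \<Longrightarrow> continuous_on (PiE {..<k} (\<lambda>_. sphere 0 1)) (F c)"
    and odd: "\<And>c i p. c \<in> set cs \<Longrightarrow> i < k \<Longrightarrow> p \<in> PiE {..<k} (\<lambda>_. sphere 0 1) \<Longrightarrow>
      F c (p(i := - p i)) = (if i \<in> \<sigma> c then - F c p else F c p)"
  shows "\<exists>p\<in>PiE {..<k} (\<lambda>_. sphere 0 1). \<forall>c\<in>set cs. F c p = 0"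
proof -
  let ?X = "PiE {..<k} (\<lambda>_. sphere (0::'a) 1)"
  obtain b :: "nat \<Rightarrow> 'a" where b: "bij_betw b {..<DIM('a)} Basis"
    using ex_bij_betw_nat_finite[of "Basis :: 'a set"] by (auto simp: atLeast0LessThan)
  have "\<exists>p\<in>?X. \<forall>c\<in>set cs. \<exists>q\<in>?X. \<exists>q'\<in>?X.
      F c q * F c q' \<le> 0 \<and> (\<forall>i<k. norm (q i - p i) \<le> inverse (real (Suc m)) \<and> norm (q' i - p i) \<le> inverse (real (Suc m)))" for m
    by (rule exists_small_sign_change[OF b adm odd]) simp_all
  then obtain p where p: "\<And>m. p m \<in> ?X" and "\<forall>m. \<forall>c\<in>set cs. \<exists>q\<in>?X. \<exists>q'\<in>?X.
      F c q * F c q' \<le> 0 \<and> (\<forall>i<k. norm (q i - p m i) \<le> inverse (real (Suc m)) \<and> norm (q' i - p m i) \<le> inverse (real (Suc m)))"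
    by metis
  then obtain q q' where q: "\<And>m c. c \<in> set cs \<Longrightarrow> q m c \<in> ?X \<and> q' m c \<in> ?X \<and> F c (q m c) * F c (q' m c) \<le> 0 \<and>
     (\<forall>i<k. norm (q m c i - p m i) \<le> inverse (real (Suc m)) \<and> norm (q' m c i - p m i) \<le> inverse (real (Suc m)))"
    by metis
  have "compact ?X" by (intro compact_PiE_fun compact_sphere)
  then obtain a r where a: "a \<in> ?X" and r: "strict_mono r" and lim: "(p \<circ> r) \<longlonglongrightarrow> a"
    using p unfolding compact_eq_seq_compact_metric seq_compact_def by metis
  have comp: "(\<lambda>m. p (r m) i) \<longlonglongrightarrow> a i" for i
    using lim by (simp add: tendsto_fun_iff)
  have close: "(\<lambda>m. z (r m)) \<longlonglongrightarrow> a"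
    if z: "\<And>m. z m \<in> ?X" "\<And>m i. i < k \<Longrightarrow> norm (z m i - p m i) \<le> inverse (real (Suc m))" for z
    unfolding tendsto_fun_iff
  proof
    fix i
    show "(\<lambda>m. z (r m) i) \<longlonglongrightarrow> a i"
    proof (cases "i < k")
      case True
      have "(\<lambda>m. inverse (real (Suc (r m)))) \<longlonglongrightarrow> 0"
        using LIMSEQ_subseq_LIMSEQ[OF LIMSEQ_inverse_real_of_nat r] by (simp add: o_def)
      then have "(\<lambda>m. z (r m) i - p (r m) i) \<longlonglongrightarrow> 0"
        by (rule Lim_null_comparison[rotated]) (use z(2)[OF True] in auto)
      from tendsto_add[OF this comp[of i]] show ?thesis by simp
    next
      case False
      then have "z m i = undefined" "a i = undefined" for m
        using z(1) a by (auto simp: PiE_iff extensional_def)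
      then show ?thesis by simp
    qed
  qed
  have "F c a = 0" if c: "c \<in> set cs" for c
  proof -
    have seq: "(\<lambda>m. F c (z m)) \<longlonglongrightarrow> F c a" if "\<And>m. z m \<in> ?X" "z \<longlonglongrightarrow> a" for z
      using cont[OF c] that a unfolding continuous_on_sequentially by (auto simp: o_def)
    have "(\<lambda>m. F c (q (r m) c) * F c (q' (r m) c)) \<longlonglongrightarrow> F c a * F c a"
      by (intro tendsto_mult seq close[of "\<lambda>m. q m c"] close[of "\<lambda>m. q' m c"]) (use q c in auto)
    then have "F c a * F c a \<le> 0"
      by (rule LIMSEQ_le_const2) (use q c in auto)
    then show ?thesis by (metis mult_le_0_iff order_antisym_conv order_refl linorder_le_cases)
  qed
  with a show ?thesis by blast
qed

section \<open>Approximate centerpoints\<close>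

text \<open>Dividing by \<open>1 + norm x\<close> makes the cutoff Lipschitz in \<open>u\<close> uniformly in \<open>x\<close>, so that its integral is
  continuous jointly in \<open>u\<close> and the measure without any tightness argument.\<close>

definition soft_half :: "real \<Rightarrow> 'a::euclidean_space \<Rightarrow> real \<Rightarrow> 'a \<Rightarrow> real" where
  "soft_half e u b x = max 0 (min 1 (2 + (u \<bullet> x - b) / (e * (1 + norm x))))"

lemma one_plus_norm_pos [simp]: "0 < 1 + norm x" "1 + norm x \<noteq> 0"
  using norm_ge_zero[of x] by linarith+

lemma soft_half_bounds: "0 \<le> soft_half e u b x" "soft_half e u b x \<le> 1"
  by (auto simp: soft_half_def)

lemma continuous_soft_half:
  assumes "e > 0"
  shows "continuous_on UNIV (soft_half e u b)"
proof -
  have "e * (1 + norm x) \<noteq> 0" for x :: 'a using assms by simp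
  then show ?thesis unfolding soft_half_def[abs_def] by (intro continuous_intros) auto
qed

lemma soft_half_antimono:
  assumes "e > 0" "b \<le> b'"
  shows "soft_half e u b' x \<le> soft_half e u b x"
proof -
  have "(u \<bullet> x - b') / (e * (1 + norm x)) \<le> (u \<bullet> x - b) / (e * (1 + norm x))"
    using assms by (intro divide_right_mono) (auto intro!: mult_nonneg_nonneg add_nonneg_nonneg)
  then show ?thesis unfolding soft_half_def by auto
qed

lemma soft_half_mono:
  assumes "0 < e" "e \<le> e'"
  shows "soft_half e u b x \<le> soft_half e' u b x"
proof (cases "u \<bullet> x - b \<ge> 0")
  case True
  then have "(u \<bullet> x - b) / (e' * (1 + norm x)) \<ge> 0"
    using assms by (intro divide_nonneg_nonneg) (auto intro!: mult_nonneg_nonneg add_nonneg_nonneg)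
  then show ?thesis unfolding soft_half_def by auto
next
  case False
  have "(b - u \<bullet> x) / (e' * (1 + norm x)) \<le> (b - u \<bullet> x) / (e * (1 + norm x))"
    using assms False by (intro divide_left_mono mult_right_mono mult_pos_pos) (auto simp: less_imp_le)
  then have "(u \<bullet> x - b) / (e * (1 + norm x)) \<le> (u \<bullet> x - b) / (e' * (1 + norm x))"
    by (metis minus_diff_eq minus_divide_left neg_le_iff_le)
  then show ?thesis unfolding soft_half_def by auto
qed

lemma soft_half_lipschitz:
  assumes "e > 0"
  shows "\<bar>soft_half e u b x - soft_half e u' b' x\<bar> \<le> (norm (u - u') + \<bar>b - b'\<bar>) / e"
proof -
  have "\<bar>(u \<bullet> x - b) - (u' \<bullet> x - b')\<bar> = \<bar>(u - u') \<bullet> x - (b - b')\<bar>"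
    by (simp add: inner_diff_left)
  also have "\<dots> \<le> norm (u - u') * norm x + \<bar>b - b'\<bar>"
    using Cauchy_Schwarz_ineq2[of "u - u'" x] by linarith
  also have "\<dots> \<le> (norm (u - u') + \<bar>b - b'\<bar>) * (1 + norm x)"
    by (simp add: algebra_simps)
  finally have "\<bar>(u \<bullet> x - b) - (u' \<bullet> x - b')\<bar> / (e * (1 + norm x))
      \<le> (norm (u - u') + \<bar>b - b'\<bar>) * (1 + norm x) / (e * (1 + norm x))"
    using assms by (intro divide_right_mono) (auto intro!: mult_nonneg_nonneg add_nonneg_nonneg)
  also have "\<dots> = (norm (u - u') + \<bar>b - b'\<bar>) / e" by simp
  finally have "\<bar>(u \<bullet> x - b) / (e * (1 + norm x)) - (u' \<bullet> x - b') / (e * (1 + norm x))\<bar>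
      \<le> (norm (u - u') + \<bar>b - b'\<bar>) / e"
    using assms by (simp add: abs_mult flip: diff_divide_distrib)
  then show ?thesis unfolding soft_half_def by (auto simp: max_def min_def)
qed

text \<open>The offset 2 in \<open>soft_half\<close> places the ramp outside the halfspace, with a
  margin of \<open>e\<close> on which the cutoff is still 1. \<open>approximate_centerpoint\<close>
  relies on this margin.\<close>

lemma soft_half_eq_1:
  assumes "e > 0" "u \<bullet> x - b \<ge> - e"
  shows "soft_half e u b x = 1"
proof -
  have "- (e * (1 + norm x)) \<le> u \<bullet> x - b"
    using assms by (simp add: algebra_simps) (smt (verit) mult_nonneg_nonneg norm_ge_zero)
  then have "- 1 \<le> (u \<bullet> x - b) / (e * (1 + norm x))"
    using assms(1) by (simp add: pos_le_divide_eq)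
  then show ?thesis by (simp add: soft_half_def)
qed

lemma soft_half_eq_0:
  assumes "e > 0" "u \<bullet> x - b \<le> - 2 * e * (1 + norm x)"
  shows "soft_half e u b x = 0"
proof -
  have "(u \<bullet> x - b) / (e * (1 + norm x)) \<le> - 2"
    using assms by (simp add: pos_divide_le_eq)
  then show ?thesis by (simp add: soft_half_def)
qed

lemma soft_half_tendsto:
  "(\<lambda>j. soft_half (inverse (real (Suc j))) u b x) \<longlonglongrightarrow> indicator {x. u \<bullet> x \<ge> b} x"
proof (cases "u \<bullet> x \<ge> b")
  case True
  then have "soft_half (inverse (real (Suc j))) u b x = 1" for j
    by (intro soft_half_eq_1) (auto intro: order_trans[of _ 0])
  then show ?thesis using True by simp
next
  case False
  have "(\<lambda>j. inverse (real (Suc j)) * (2 * (1 + norm x))) \<longlonglongrightarrow> 0 * (2 * (1 + norm x))"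
    by (intro tendsto_intros LIMSEQ_inverse_real_of_nat)
  moreover from False have "0 < b - u \<bullet> x" by simp
  ultimately have "\<forall>\<^sub>F j in sequentially. inverse (real (Suc j)) * (2 * (1 + norm x)) < b - u \<bullet> x"
    using order_tendstoD(2)[of _ "0 * (2 * (1 + norm x))"] by (metis mult_zero_left)
  then have "\<forall>\<^sub>F j in sequentially. soft_half (inverse (real (Suc j))) u b x = 0"
    by eventually_elim (rule soft_half_eq_0, simp, simp add: algebra_simps)
  then show ?thesis using False by (simp add: tendsto_eventually)
qed

section \<open>Integration against mass distributions, Helly's theorem and centerpoints\<close>

lemma mass_distributionD:
  assumes "mass_distribution h M"
  shows "space M = h" "finite_measure M" "0 < measure M h"
    "\<And>U. open U \<Longrightarrow> U \<inter> h \<in> sets M"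
    "\<And>C. closed C \<Longrightarrow> C \<inter> h \<in> sets M"
proof -
  show sp: "space M = h" using assms by (simp add: mass_distribution_def)
  show fin: "finite_measure M"
    by (rule finite_measureI) (use assms in \<open>auto simp: mass_distribution_def\<close>)
  show "0 < measure M h"
    using assms by (auto simp: mass_distribution_def measure_def enn2real_positive_iff)
  show op: "U \<inter> h \<in> sets M" if "open U" for U
    using assms that by (auto simp: mass_distribution_def openin_open Int_commute)
  show "C \<inter> h \<in> sets M" if "closed C" for C
  proof -
    have "space M - (- C \<inter> h) \<in> sets M"
      by (intro sets.compl_sets op) (use that in auto)
    moreover have "space M - (- C \<inter> h) = C \<inter> h" using sp by auto
    ultimately show ?thesis by simp
  qed
qed

lemma mass_distribution_measurable:
  fixes f :: "'a::euclidean_space \<Rightarrow> real"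
  assumes "mass_distribution h M" "continuous_on UNIV f"
  shows "f \<in> borel_measurable M"
proof (rule borel_measurableI)
  fix S :: "real set" assume "open S"
  then have "open (f -` S)" using assms(2) by (simp add: open_vimage)
  then show "f -` S \<inter> space M \<in> sets M"
    using mass_distributionD[OF assms(1)] by simp
qed

lemma mass_distribution_integrable:
  fixes f :: "'a::euclidean_space \<Rightarrow> real"
  assumes "mass_distribution h M" "continuous_on UNIV f" "\<And>x. \<bar>f x\<bar> \<le> B"
  shows "integrable M f"
  using mass_distribution_measurable[OF assms(1,2)] mass_distributionD(2)[OF assms(1)] assms(3)
  by (intro finite_measure.integrable_const_bound[where B = B]) auto

lemma integrable_soft_half:
  assumes "mass_distribution h M" "e > 0"
  shows "integrable M (soft_half e u b)"
proof (rule mass_distribution_integrable[OF assms(1) continuous_soft_half[OF assms(2)]])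
  show "\<bar>soft_half e u b x\<bar> \<le> 1" for x
    using soft_half_bounds[of e u b x] by simp
qed

lemma integral_const_mass:
  assumes "mass_distribution h M"
  shows "(\<integral>x. c \<partial>M) = c * measure M h"
  using mass_distributionD[OF assms] by (simp add: finite_measure.emeasure_finite)

lemma measure_le_integral:
  fixes f :: "'a::euclidean_space \<Rightarrow> real"
  assumes "mass_distribution h M" "A \<in> sets M" "integrable M f" "\<And>x. x \<in> h \<Longrightarrow> indicator A x \<le> f x"
  shows "measure M A \<le> integral\<^sup>L M f"
proof -
  interpret finite_measure M using mass_distributionD[OF assms(1)] by simp
  have "measure M A = (\<integral>x. indicator A x \<partial>M)"
    using assms(2) sets.sets_into_space by (simp add: Int_absorb2)
  also have "\<dots> \<le> integral\<^sup>L M f"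
    using assms mass_distributionD(1)[OF assms(1)]
    by (intro integral_mono) (auto simp: emeasure_finite less_top[symmetric])
  finally show ?thesis .
qed

text \<open>The usual derivation from Radon's theorem, with all chosen points in \<open>L\<close>.
  Counting against \<open>dim L\<close> rather than the ambient dimension is what gives the depth
  \<open>1 / (m + 1)\<close>.\<close>

lemma Helly_subspace:
  fixes F :: "'a::euclidean_space set set"
  assumes "finite F" "F \<noteq> {}" "\<And>S. S \<in> F \<Longrightarrow> convex S \<and> S \<subseteq> L"
    and "\<And>T. T \<subseteq> F \<Longrightarrow> T \<noteq> {} \<Longrightarrow> card T \<le> dim L + 1 \<Longrightarrow> \<Inter>T \<noteq> {}"
  shows "\<Inter>F \<noteq> {}"
  using assms
proof (induction "card F" arbitrary: F)
  case 0
  then show ?case by auto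
next
  case (Suc n)
  show ?case
  proof (cases "Suc n \<le> dim L + 1")
    case True
    then show ?thesis using Suc.hyps(2) Suc.prems(2) by (intro Suc.prems(4)) auto
  next
    case False
    have "\<Inter>(F - {S}) \<noteq> {}" if "S \<in> F" for S
    proof (rule Suc.hyps(1))
      show "n = card (F - {S})" using Suc.hyps(2) Suc.prems(1) that by simp
      then have "card (F - {S}) \<noteq> 0" using False by simp
      then show "F - {S} \<noteq> {}" by (metis card.empty)
      show "\<Inter>T \<noteq> {}" if "T \<subseteq> F - {S}" "T \<noteq> {}" "card T \<le> dim L + 1" for T
        using that by (intro Suc.prems(4)) auto
    qed (use Suc.prems in auto)
    then have "\<forall>S\<in>F. \<exists>x. x \<in> \<Inter>(F - {S})" by blast
    then obtain X where X: "\<And>S. S \<in> F \<Longrightarrow> X S \<in> \<Inter>(F - {S})"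
      by metis
    have XL: "X S \<in> L" if S: "S \<in> F" for S
    proof -
      have "card (F - {S}) \<noteq> 0" using False Suc.hyps(2) Suc.prems(1) S by simp
      then have "F - {S} \<noteq> {}" by (metis card.empty)
      then obtain T where "T \<in> F - {S}" by blast
      then show ?thesis using X[OF S] Suc.prems(3) by blast
    qed
    show ?thesis
    proof (cases "inj_on X F")
      case False
      then obtain S T where "S \<noteq> T" "S \<in> F" "T \<in> F" "X S = X T" by (auto simp: inj_on_def)
      then have "X S \<in> \<Inter>F" using X[of S] X[of T] by auto
      then show ?thesis by blast
    next
      case True
      have "dim (X ` F) \<le> dim L" by (rule dim_subset) (use XL in blast)
      moreover have "card (X ` F) = Suc n" using True Suc.hyps(2) by (simp add: card_image)
      ultimately have "affine_dependent (X ` F)"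
        using False Suc.prems(1) by (intro affine_dependent_biggerset_general) auto
      then obtain A B where AB: "A \<inter> B = {}" "A \<union> B = X ` F" "convex hull A \<inter> convex hull B \<noteq> {}"
        using Radon_partition[of "X ` F"] Suc.prems(1) by auto
      have sub: "convex hull A \<subseteq> S" if "S \<in> F" "X S \<notin> A" "A \<subseteq> X ` F" for S A
      proof (rule hull_minimal)
        show "A \<subseteq> S" using X that by blast
        show "convex S" using Suc.prems(3) that(1) by blast
      qed
      have "convex hull A \<inter> convex hull B \<subseteq> \<Inter>F"
      proof
        fix x assume x: "x \<in> convex hull A \<inter> convex hull B"
        show "x \<in> \<Inter>F"
        proof
          fix S assume S: "S \<in> F"
          show "x \<in> S"
          proof (cases "X S \<in> A")
            case True
            then have "X S \<notin> B" using AB(1) by blast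
            then show ?thesis using sub[of S B] S AB(2) x by blast
          next
            case False
            then show ?thesis using sub[of S A] S AB(2) x by blast
          qed
        qed
      qed
      then show ?thesis using AB(3) by blast
    qed
  qed
qed

text \<open>At most \<open>dim L + 1\<close> open halfspaces, each of mass below the fraction
  \<open>c\<close>, and the outside of a large ball cannot cover \<open>h\<close>. Hence their
  complements meet, by Helly any finite number of them meets in \<open>L\<close>, and by compactness
  all do. The point works for every width \<open>e\<close> at once.\<close>

lemma approximate_centerpoint:
  fixes h L :: "'a::euclidean_space set"
  assumes M: "mass_distribution h M" and L: "subspace L" and c: "0 \<le> c" "c * real (dim L + 1) < 1"
  obtains q where "q \<in> L" "\<And>u e. u \<in> L \<Longrightarrow> norm u = 1 \<Longrightarrow> e > 0 \<Longrightarrow>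
    c * measure M h \<le> (\<integral>x. soft_half e u (u \<bullet> q) x \<partial>M)"
proof -
  interpret finite_measure M using mass_distributionD[OF M] by simp
  note sp = mass_distributionD(1)[OF M]
  let ?t = "measure M h"
  have t: "?t > 0" using mass_distributionD[OF M] by simp
  have opn: "{x \<in> h. P x} \<in> sets M" if "open {x. P x}" for P
    using mass_distributionD(4)[OF M that] by (simp add: Collect_conj_eq Int_commute)
  have "(\<lambda>j. measure M {x \<in> h. norm x > real j}) \<longlonglongrightarrow> measure M (\<Inter>j. {x \<in> h. norm x > real j})"
  proof (rule finite_Lim_measure_decseq)
    show "range (\<lambda>j. {x \<in> h. norm x > real j}) \<subseteq> sets M"
      by (auto intro!: opn open_Collect_less continuous_intros)
  qed (auto simp: decseq_def)
  moreover have "(\<Inter>j. {x \<in> h. norm x > real j}) = {}"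
  proof (rule equals0I)
    fix y assume y: "y \<in> (\<Inter>j. {x \<in> h. norm x > real j})"
    obtain j where "norm y < real j" using reals_Archimedean2 by blast
    moreover have "norm y > real j" using y by blast
    ultimately show False by simp
  qed
  \<comment> \<open>The slack in \<open>c * real (dim L + 1) < 1\<close> pays for the mass outside
    the ball, which is needed for compactness.\<close>
  moreover have "0 < (1 - c * real (dim L + 1)) * ?t" using c t by simp
  ultimately have "\<forall>\<^sub>F j in sequentially. measure M {x \<in> h. norm x > real j} < (1 - c * real (dim L + 1)) * ?t"
    by (intro order_tendstoD(2)) simp_all
  then obtain R where R: "measure M {x \<in> h. norm x > real R} < (1 - c * real (dim L + 1)) * ?t"
    by (auto simp: eventually_sequentially)
  \<comment> \<open>The open halfspaces with normal in \<open>L\<close> that are too light; a deep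
    point has to avoid them all, that is, lie in every \<open>H a\<close>.\<close>
  define A where "A = {(u, b). u \<in> L \<and> measure M {x \<in> h. u \<bullet> x > b} < c * ?t}"
  define H where "H = (\<lambda>(u, b). {z \<in> L. u \<bullet> z \<le> b} \<inter> cball 0 (real R))"
  let ?B = "L \<inter> cball 0 (real R)"
  have closedL: "closed L" using L by (rule closed_subspace)
  have "?B \<inter> (\<Inter>a\<in>A. H a) \<noteq> {}"
  proof (rule compact_imp_fip_image)
    show "compact ?B" using closedL by (simp add: closed_Int_compact)
    show "closed (H a)" if "a \<in> A" for a
    proof -
      have "H a = L \<inter> {z. fst a \<bullet> z \<le> snd a} \<inter> cball 0 (real R)" by (auto simp: H_def split: prod.splits)
      then show ?thesis using closedL closed_halfspace_le by (auto intro!: closed_Int)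
    qed
    show "?B \<inter> (\<Inter>a\<in>A'. H a) \<noteq> {}" if A': "finite A'" "A' \<subseteq> A" for A'
    proof (cases "A' = {}")
      case True
      have "0 \<in> ?B" using L by (simp add: subspace_0)
      then show ?thesis using True by blast
    next
      case False
      have "\<Inter>(H ` A') \<noteq> {}"
      proof (rule Helly_subspace)
        show "convex S \<and> S \<subseteq> L" if S: "S \<in> H ` A'" for S
        proof -
          obtain u b where "S = H (u, b)" using S by auto
          then have "S = L \<inter> {z. u \<bullet> z \<le> b} \<inter> cball 0 (real R)" by (auto simp: H_def)
          then show ?thesis 
            using convex_Int[OF convex_Int[OF subspace_imp_convex[OF L] convex_halfspace_le] convex_cball]
            by auto
        qed
        fix T assume T: "T \<subseteq> H ` A'" "T \<noteq> {}" "card T \<le> dim L + 1"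
        then obtain A'' where A'': "A'' \<subseteq> A'" "inj_on H A''" "T = H ` A''"
          by (metis subset_image_inj)
        have fin: "finite A''" using A'' A' finite_subset by blast
        have card: "card A'' \<le> dim L + 1" using A'' T(3) by (simp add: card_image)
        let ?E = "\<lambda>a. {x \<in> h. fst a \<bullet> x > snd a}"
        have E: "?E a \<in> sets M" for a by (auto intro!: opn open_halfspace_gt)
        have N: "{x \<in> h. norm x > real R} \<in> sets M"
          by (auto intro!: opn open_Collect_less continuous_intros)
        have "measure M ((\<Union>a\<in>A''. ?E a) \<union> {x \<in> h. norm x > real R})
          \<le> measure M (\<Union>a\<in>A''. ?E a) + measure M {x \<in> h. norm x > real R}"
          by (rule measure_Un_le) (use E N fin in auto)
        also have "measure M (\<Union>a\<in>A''. ?E a) \<le> (\<Sum>a\<in>A''. measure M (?E a))"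
          by (rule measure_UNION_le) (use E fin in auto)
        also have "\<dots> \<le> real (card A'') * (c * ?t)"
          by (rule sum_bounded_above) (use A'' A' in \<open>force simp: A_def\<close>)
        also have "\<dots> \<le> real (dim L + 1) * (c * ?t)"
          using card c t by (intro mult_right_mono) auto
        finally have "measure M ((\<Union>a\<in>A''. ?E a) \<union> {x \<in> h. norm x > real R}) < ?t"
          using R by (simp add: algebra_simps)
        then have "(\<Union>a\<in>A''. ?E a) \<union> {x \<in> h. norm x > real R} \<noteq> h" by auto
        then obtain x where x: "x \<in> h" "norm x \<le> real R" "\<And>a. a \<in> A'' \<Longrightarrow> fst a \<bullet> x \<le> snd a"
          by (force simp: not_less)
        \<comment> \<open>The point \<open>x\<close> is in \<open>h\<close> but perhaps not in
          \<open>L\<close>. Its projection \<open>y\<close> to \<open>L\<close> has the same inner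
          products with \<open>L\<close> and no larger norm.\<close>
        obtain y z where yz: "y \<in> span L" "\<And>w. w \<in> span L \<Longrightarrow> orthogonal z w" "x = y + z"
          using orthogonal_subspace_decomp_exists[of L x] by metis
        have spanL: "span L = L" using L by (simp add: span_eq_iff)
        have inner: "w \<bullet> y = w \<bullet> x" if "w \<in> L" for w
          using yz(2)[of w] that by (simp add: yz(3) spanL orthogonal_def inner_add_right inner_commute)
        have "norm y * norm y \<le> norm y * norm x"
          using inner[of y] yz(1) norm_cauchy_schwarz[of y x] by (simp add: spanL dot_square_norm power2_eq_square)
        then have "norm y \<le> real R" using x(2)
          by (metis mult_le_cancel_left_pos norm_ge_zero order_le_less order_trans of_nat_0_le_iff)
        then have "y \<in> H a" if "a \<in> A''" for a
          using x(3)[OF that] that A'' A' yz(1) by (auto simp: H_def A_def spanL inner split: prod.splits)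
        then show "\<Inter>T \<noteq> {}" unfolding A''(3) by blast
      qed (use A' False in auto)
      moreover have "\<Inter>(H ` A') \<subseteq> ?B" using False by (auto simp: H_def)
      ultimately show ?thesis by blast
    qed
  qed
  then obtain q where q: "q \<in> L" "\<And>a. a \<in> A \<Longrightarrow> q \<in> H a" by blast
  show thesis
  proof (rule that[OF q(1)])
    fix u :: 'a and e :: real assume u: "u \<in> L" "norm u = 1" and e: "e > 0"
    show "c * ?t \<le> (\<integral>x. soft_half e u (u \<bullet> q) x \<partial>M)"
    proof (rule ccontr)
      assume "\<not> ?thesis"
      moreover have "measure M {x \<in> h. u \<bullet> x > u \<bullet> q - e} \<le> (\<integral>x. soft_half e u (u \<bullet> q) x \<partial>M)"
      proof (rule measure_le_integral[OF M])
        show "{x \<in> h. u \<bullet> x > u \<bullet> q - e} \<in> sets M" by (auto intro!: opn open_halfspace_gt)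
        show "indicator {x \<in> h. u \<bullet> x > u \<bullet> q - e} x \<le> soft_half e u (u \<bullet> q) x" for x
          using soft_half_eq_1[OF e, of u x "u \<bullet> q"] soft_half_bounds(1) by (auto simp: indicator_def)
      qed (use integrable_soft_half[OF M e] in simp)
      \<comment> \<open>The cutoff dominates the indicator of the halfspace shifted outwards by
        \<open>e\<close>; if that were light, \<open>q\<close> would have to lie in its
        complement.\<close>
      ultimately have "(u, u \<bullet> q - e) \<in> A" using u by (auto simp: A_def)
      then have "q \<in> H (u, u \<bullet> q - e)" by (rule q(2))
      then show False using e by (simp add: H_def)
    qed
  qed
qed

section \<open>Conditions on frames\<close>

lemma admissible_append_singletons:
  assumes "\<And>c. c \<in> set bs \<Longrightarrow> \<iota> c = j \<and> \<sigma> c = {j}" "j < k" "length bs \<le> n j"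
    and "admissible k \<sigma> \<iota> cs (n(j := n j - length bs))"
  shows "admissible k \<sigma> \<iota> (bs @ cs) n"
  using assms
proof (induction bs arbitrary: n)
  case (Cons c bs)
  have c: "\<iota> c = j" "\<sigma> c = {j}" using Cons.prems(1)[of c] by auto
  have "(n(j := n j - 1))(j := (n(j := n j - 1)) j - length bs) = n(j := n j - length (c # bs))"
    by (simp add: fun_eq_iff)
  then have adm: "admissible k \<sigma> \<iota> cs ((n(j := n j - 1))(j := (n(j := n j - 1)) j - length bs))"
    using Cons.prems(4) by (simp only:)
  have "admissible k \<sigma> \<iota> (bs @ cs) (n(j := n j - 1))"
    by (rule Cons.IH[OF _ _ _ adm]) (use Cons.prems(1-3) in auto)
  then show ?case using Cons.prems(2,3) by (simp add: c)
qed simp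

text \<open>Row \<open>i\<close> is used up, so each factor reduces to the variable of its pivot;
  distinct pivots lower each exponent at most once.\<close>

lemma admissible_append_pairs:
  assumes "\<And>c. c \<in> set bs \<Longrightarrow> \<iota> c < k \<and> 0 < n (\<iota> c) \<and> \<iota> c \<noteq> i \<and> \<sigma> c = {i, \<iota> c}"
    and "distinct (map \<iota> bs)" "n i = 0"
    and "admissible k \<sigma> \<iota> cs (\<lambda>j. if j \<in> \<iota> ` set bs then n j - 1 else n j)"
  shows "admissible k \<sigma> \<iota> (bs @ cs) n"
  using assms
proof (induction bs arbitrary: n)
  case (Cons c bs)
  have "(\<lambda>j. if j \<in> \<iota> ` set bs then (n(\<iota> c := n (\<iota> c) - 1)) j - 1 else (n(\<iota> c := n (\<iota> c) - 1)) j)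
    = (\<lambda>j. if j \<in> \<iota> ` set (c # bs) then n j - 1 else n j)"
    using Cons.prems(2) by auto
  then have adm: "admissible k \<sigma> \<iota> cs (\<lambda>j. if j \<in> \<iota> ` set bs then (n(\<iota> c := n (\<iota> c) - 1)) j - 1
      else (n(\<iota> c := n (\<iota> c) - 1)) j)"
    using Cons.prems(4) by (simp only:)
  have "admissible k \<sigma> \<iota> (bs @ cs) (n(\<iota> c := n (\<iota> c) - 1))"
  proof (rule Cons.IH[OF _ _ _ adm])
    show "\<iota> b < k \<and> 0 < (n(\<iota> c := n (\<iota> c) - 1)) (\<iota> b) \<and> \<iota> b \<noteq> i \<and> \<sigma> b = {i, \<iota> b}" if "b \<in> set bs" for b
    proof -
      have "\<iota> b \<noteq> \<iota> c" using Cons.prems(2) that by (metis distinct.simps(2) image_eqI list.set_map list.simps(9))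
      moreover have "b \<in> set (c # bs)" using that by simp
      ultimately show ?thesis using Cons.prems(1)[of b] unfolding fun_upd_apply by metis
    qed
    have "\<iota> c \<noteq> i" using Cons.prems(1)[of c] by simp
    then show "(n(\<iota> c := n (\<iota> c) - 1)) i = 0" using Cons.prems(3) by simp
    show "distinct (map \<iota> bs)" using Cons.prems(2) by simp
  qed
  moreover have "\<iota> c < k" "0 < n (\<iota> c)" "\<sigma> c = {i, \<iota> c}" using Cons.prems(1)[of c] by auto
  ultimately show ?case using Cons.prems(3) by auto
qed simp

text \<open>\<open>Inl (i, j)\<close> stands for the orthogonality of the frame vectors \<open>i\<close> and \<open>j\<close>, and \<open>Inr (l, j)\<close> for
  the vanishing of the \<open>j\<close>-th component of the \<open>l\<close>-th section of the tautological bundle.\<close>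

type_synonym frame_condition = "nat \<times> nat + nat \<times> nat"

fun parity_set :: "frame_condition \<Rightarrow> nat set" where
  "parity_set (Inl (i, j)) = {i, j}"
| "parity_set (Inr (l, j)) = {j}"

fun pivot :: "frame_condition \<Rightarrow> nat" where
  "pivot (Inl (i, j)) = j"
| "pivot (Inr (l, j)) = j"

definition pair_conditions :: "nat \<Rightarrow> nat \<Rightarrow> frame_condition list" where
  "pair_conditions i k = concat (map (\<lambda>i. map (\<lambda>j. Inl (i, j)) [Suc i..<k]) [i..<k])"

definition section_conditions :: "nat \<Rightarrow> nat \<Rightarrow> frame_condition list" where
  "section_conditions m s = concat (map (\<lambda>j. map (\<lambda>l. Inr (l, j)) [0..<s]) [0..<m])"

text \<open>At stage \<open>i\<close> row \<open>i\<close> has exponent 0, and the pairs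
  \<open>(i, j)\<close> take one from every later row. In cohomology, the product of all
  \<open>x i + x j\<close> with \<open>i < j\<close> collapses to the product of the
  \<open>x j ^ j\<close>, since each \<open>x j ^ (j + 1)\<close> is 0.\<close>

lemma admissible_pair_conditions:
  assumes "\<And>j. j < k \<Longrightarrow> n j = j - i"
  shows "admissible k parity_set pivot (pair_conditions i k) n"
  using assms
proof (induction "k - i" arbitrary: i n)
  case 0
  then show ?case by (simp add: pair_conditions_def)
next
  case (Suc q)
  let ?bs = "map (\<lambda>j. Inl (i, j)) [Suc i..<k] :: frame_condition list"
  have piv: "pivot ` set ?bs = {Suc i..<k}" by force
  have split: "pair_conditions i k = ?bs @ pair_conditions (Suc i) k"
    using Suc.hyps(2) by (simp add: pair_conditions_def upt_conv_Cons)
  show ?case unfolding split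
  proof (rule admissible_append_pairs[where i = i])
    show "admissible k parity_set pivot (pair_conditions (Suc i) k)
        (\<lambda>j. if j \<in> pivot ` set ?bs then n j - 1 else n j)"
      unfolding piv by (rule Suc.hyps(1)) (use Suc.hyps(2) Suc.prems in auto)
  qed (use Suc.hyps(2) Suc.prems in \<open>auto simp: distinct_map inj_on_def\<close>)
qed

lemma admissible_section_conditions:
  assumes "m \<le> k" "\<And>j. j < m \<Longrightarrow> s \<le> n j"
    and "admissible k parity_set pivot cs (\<lambda>j. if j < m then n j - s else n j)"
  shows "admissible k parity_set pivot (section_conditions m s @ cs) n"
  using assms
proof (induction m arbitrary: cs)
  case (Suc m)
  let ?bs = "map (\<lambda>l. Inr (l, m)) [0..<s] :: frame_condition list"
  have split: "section_conditions (Suc m) s = section_conditions m s @ ?bs"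
    by (simp add: section_conditions_def)
  have "admissible k parity_set pivot (section_conditions m s @ ?bs @ cs) n"
  proof (rule Suc.IH)
    let ?n = "\<lambda>j. if j < m then n j - s else n j"
    show "admissible k parity_set pivot (?bs @ cs) ?n"
    proof (rule admissible_append_singletons[where j = m])
      have "?n(m := ?n m - length ?bs) = (\<lambda>j. if j < Suc m then n j - s else n j)"
        by (auto simp: fun_eq_iff less_Suc_eq)
      then show "admissible k parity_set pivot cs (?n(m := ?n m - length ?bs))"
        using Suc.prems(3) by (simp only:)
    qed (use Suc.prems in auto)
  qed (use Suc.prems in auto)
  then show ?case by (simp add: split)
qed (simp add: section_conditions_def)

text \<open>The sections come first: they are pure powers \<open>x j ^ s\<close>, and removing them
  leaves the exponents that the orthogonality relations need.\<close>

lemma admissible_frame_conditions: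
  assumes "m \<le> k"
  shows "admissible k parity_set pivot (section_conditions m s @ pair_conditions 0 k)
    (\<lambda>i. if i < m then s + i else i)"
proof (rule admissible_section_conditions[OF assms])
  show "admissible k parity_set pivot (pair_conditions 0 k)
     (\<lambda>j. if j < m then (if j < m then s + j else j) - s else if j < m then s + j else j)"
    by (rule admissible_pair_conditions) simp
qed simp

lemma set_pair_conditions: "set (pair_conditions 0 k) = {Inl (i, j) | i j. i < j \<and> j < k}"
  by (fastforce simp: pair_conditions_def)

lemma set_section_conditions: "set (section_conditions m s) = {Inr (l, j) | l j. l < s \<and> j < m}"
  by (auto simp: section_conditions_def)

section \<open>Mass assignments along frames\<close>

lemma orthonormal_frames_inner:
  assumes "v \<in> orthonormal_frames k" "i < k" "j < k"
  shows "v i \<bullet> v j = (if i = j then 1 else 0)"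
  using assms by (auto simp: orthonormal_frames_def)

lemma orthonormal_frames_alt:
  "orthonormal_frames k = {v \<in> PiE {..<k} (\<lambda>_. sphere 0 1). \<forall>i<k. \<forall>j<k. i < j \<longrightarrow> v i \<bullet> v j = 0}"
proof (intro equalityI subsetI)
  fix v :: "nat \<Rightarrow> 'a" assume "v \<in> orthonormal_frames k"
  then show "v \<in> {v \<in> PiE {..<k} (\<lambda>_. sphere 0 1). \<forall>i<k. \<forall>j<k. i < j \<longrightarrow> v i \<bullet> v j = 0}"
    by (auto simp: orthonormal_frames_def PiE_iff norm_eq_1)
next
  fix v :: "nat \<Rightarrow> 'a"
  assume v: "v \<in> {v \<in> PiE {..<k} (\<lambda>_. sphere 0 1). \<forall>i<k. \<forall>j<k. i < j \<longrightarrow> v i \<bullet> v j = 0}"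
  have "v i \<bullet> v j = (if i = j then 1 else 0)" if "i < k" "j < k" for i j
  proof -
    have "v i \<bullet> v i = 1" using v that(1) by (auto simp: PiE_iff simp flip: norm_eq_1)
    moreover have "v i \<bullet> v j = 0" if "i \<noteq> j"
    proof (cases "i < j")
      case True
      then show ?thesis using v \<open>i < k\<close> \<open>j < k\<close> by auto
    next
      case False
      then have "v j \<bullet> v i = 0" using v \<open>i < k\<close> \<open>j < k\<close> that by auto
      then show ?thesis by (simp add: inner_commute)
    qed
    ultimately show ?thesis by auto
  qed
  then show "v \<in> orthonormal_frames k" using v by (auto simp: orthonormal_frames_def PiE_iff)
qed

lemma compact_orthonormal_frames: "compact (orthonormal_frames k :: (nat \<Rightarrow> 'a::euclidean_space) set)"
proof -
  have eq: "orthonormal_frames k = PiE {..<k} (\<lambda>_. sphere (0::'a) 1) \<inter>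
      (\<Inter>i\<in>{..<k}. \<Inter>j\<in>{..<k}. {v. i < j \<longrightarrow> v i \<bullet> v j = 0})"
    unfolding orthonormal_frames_alt by auto
  have "closed {v :: nat \<Rightarrow> 'a. i < j \<longrightarrow> v i \<bullet> v j = 0}" for i j
    by (cases "i < j") (auto intro!: closed_Collect_eq continuous_intros)
  then have "closed (\<Inter>i\<in>{..<k}. \<Inter>j\<in>{..<k}. {v :: nat \<Rightarrow> 'a. i < j \<longrightarrow> v i \<bullet> v j = 0})"
    by (intro closed_INT ballI)
  then show ?thesis unfolding eq by (intro compact_Int_closed compact_PiE_fun compact_sphere)
qed

lemma frame_span_expand:
  assumes "v \<in> orthonormal_frames k" "m \<le> k" "u \<in> frame_span m v"
  shows "(\<Sum>i<m. (u \<bullet> v i) *\<^sub>R v i) = u"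
proof -
  have "subspace {u. (\<Sum>i<m. (u \<bullet> v i) *\<^sub>R v i) = u}"
    by (rule subspaceI)
      (auto simp: inner_add_left scaleR_add_left sum.distrib simp flip: scaleR_scaleR scaleR_sum_right)
  moreover have "v ` {..<m} \<subseteq> {u. (\<Sum>i<m. (u \<bullet> v i) *\<^sub>R v i) = u}"
  proof
    fix x assume "x \<in> v ` {..<m}"
    then obtain j where j: "j < m" "x = v j" by auto
    have "(\<Sum>i<m. (v j \<bullet> v i) *\<^sub>R v i) = (\<Sum>i<m. if j = i then v i else 0)"
      by (rule sum.cong) (use orthonormal_frames_inner[OF assms(1)] assms(2) j in auto)
    then show "x \<in> {u. (\<Sum>i<m. (u \<bullet> v i) *\<^sub>R v i) = u}" using j by simp
  qed
  ultimately have "frame_span m v \<subseteq> {u. (\<Sum>i<m. (u \<bullet> v i) *\<^sub>R v i) = u}"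
    unfolding frame_span_def by (rule span_minimal[rotated])
  then show ?thesis using assms(3) by auto
qed

lemma frame_span_sum: "(\<Sum>i<m. c i *\<^sub>R v i) \<in> frame_span m v"
  unfolding frame_span_def by (intro span_sum span_scale span_base) auto

lemma subspace_frame_span: "subspace (frame_span m v)"
  by (simp add: frame_span_def)

lemma dim_frame_span:
  assumes "v \<in> orthonormal_frames k" "m \<le> k"
  shows "dim (frame_span m v) = m"
proof -
  have "restrict v {..<m} \<in> orthonormal_frames m"
    using assms by (auto simp: orthonormal_frames_def)
  then have "frame_span m (restrict v {..<m}) \<in> grassmannian m"
    by (rule frame_span_in_grassmannian)
  then show ?thesis by (simp add: grassmannian_def frame_span_def)
qed

lemma flip_orthonormal_frames:
  assumes "v \<in> orthonormal_frames k" "i < k"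
  shows "v(i := - v i) \<in> orthonormal_frames k"
  using assms by (auto simp: orthonormal_frames_def extensional_def)

lemma frame_span_flip: "frame_span m (v(i := - v i)) = frame_span m v"
proof -
  have "frame_span m (w(i := - w i)) \<subseteq> frame_span m w" for w :: "nat \<Rightarrow> 'a"
    unfolding frame_span_def
  proof (rule span_minimal)
    show "(w(i := - w i)) ` {..<m} \<subseteq> span (w ` {..<m})"
      by (auto intro: span_neg span_base)
  qed simp
  from this[of v] this[of "v(i := - v i)"] show ?thesis by simp
qed

text \<open>Connects \<open>stiefel_topology\<close> with the metric on functions, so that weak
  continuity can be used along convergent sequences of frames.\<close>

lemma continuous_map_top_of_set_stiefel:
  "continuous_map (top_of_set (orthonormal_frames k)) (stiefel_topology k) (\<lambda>v. v)"
proof -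
  have "continuous_map (top_of_set (orthonormal_frames k)) euclidean (\<lambda>v :: nat \<Rightarrow> 'a. v i)" for i
    by (simp add: continuous_on_subset[OF continuous_on_product_coordinates])
  then show ?thesis
    unfolding stiefel_topology_def
    by (auto simp: continuous_map_in_subtopology continuous_map_componentwise orthonormal_frames_def)
qed

lemma mass_assignment_integral_tendsto:
  fixes f :: "'a::euclidean_space \<Rightarrow> real"
  assumes \<mu>: "mass_assignment k \<mu>" and f: "continuous_on UNIV f" "\<And>x. \<bar>f x\<bar> \<le> B"
    and v: "\<And>j. v j \<in> orthonormal_frames k" "w \<in> orthonormal_frames k" "v \<longlonglongrightarrow> w"
  shows "(\<lambda>j. \<integral>x. f x \<partial>\<mu> (frame_span k (v j))) \<longlonglongrightarrow> (\<integral>x. f x \<partial>\<mu> (frame_span k w))"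
proof -
  have "bounded (range f)" using f(2) by (auto simp: bounded_iff intro!: exI[of _ B])
  then have "continuous_map (grassmannian_topology k) euclideanreal (\<lambda>h. integral\<^sup>L (\<mu> h) f)"
    using \<mu> f(1) by (auto simp: mass_assignment_def)
  then have "continuous_map (top_of_set (orthonormal_frames k)) euclideanreal
      ((\<lambda>h. integral\<^sup>L (\<mu> h) f) \<circ> (frame_span k \<circ> (\<lambda>v. v)))"
    by (intro continuous_map_compose[OF continuous_map_compose[OF continuous_map_top_of_set_stiefel
          quotient_imp_continuous_map[OF quotient_map_frame_span]]])
  then have "continuous_on (orthonormal_frames k) (\<lambda>v. integral\<^sup>L (\<mu> (frame_span k v)) f)"
    by (simp add: o_def)
  then show ?thesis
    using v unfolding continuous_on_sequentially by (auto simp: o_def)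
qed

lemma mass_assignmentD:
  assumes "mass_assignment k \<mu>" "v \<in> orthonormal_frames k"
  shows "mass_distribution (frame_span k v) (\<mu> (frame_span k v))"
  using assms frame_span_in_grassmannian by (auto simp: mass_assignment_def)

abbreviation total_mass :: "nat \<Rightarrow> ('a::euclidean_space set \<Rightarrow> 'a measure) \<Rightarrow> (nat \<Rightarrow> 'a) \<Rightarrow> real" where
  "total_mass k \<mu> v \<equiv> measure (\<mu> (frame_span k v)) (frame_span k v)"

lemma total_mass_tendsto:
  assumes "mass_assignment k \<mu>" "\<And>j. v j \<in> orthonormal_frames k" "w \<in> orthonormal_frames k" "v \<longlonglongrightarrow> w"
  shows "(\<lambda>j. total_mass k \<mu> (v j)) \<longlonglongrightarrow> total_mass k \<mu> w"
proof -
  have "(\<lambda>j. \<integral>x. 1 \<partial>\<mu> (frame_span k (v j))) \<longlonglongrightarrow> (\<integral>x. (1::real) \<partial>\<mu> (frame_span k w))"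
    by (rule mass_assignment_integral_tendsto[OF assms(1) _ _ assms(2-4), where B = 1]) auto
  moreover have "(\<integral>x. (1::real) \<partial>\<mu> (frame_span k v)) = total_mass k \<mu> v"
    if "v \<in> orthonormal_frames k" for v
    by (subst integral_const_mass[OF mass_assignmentD[OF assms(1) that]]) simp
  ultimately show ?thesis using assms(2,3) by (simp only:)
qed

text \<open>Measure and integrand vary together. With the integrand frozen at its limit this is weak
  continuity; the error is at most the uniform Lipschitz bound times the total mass, which
  converges.\<close>

lemma soft_half_integral_tendsto:
  assumes \<mu>: "mass_assignment k \<mu>" and "e > 0"
    and v: "\<And>j. v j \<in> orthonormal_frames k" "w \<in> orthonormal_frames k" "v \<longlonglongrightarrow> w"
    and u: "u \<longlonglongrightarrow> u'" and b: "b \<longlonglongrightarrow> b'"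
  shows "(\<lambda>j. \<integral>x. soft_half e (u j) (b j) x \<partial>\<mu> (frame_span k (v j)))
    \<longlonglongrightarrow> (\<integral>x. soft_half e u' b' x \<partial>\<mu> (frame_span k w))"
proof -
  let ?I = "\<lambda>j a c. \<integral>x. soft_half e a c x \<partial>\<mu> (frame_span k (v j))"
  let ?r = "\<lambda>j. (norm (u j - u') + \<bar>b j - b'\<bar>) / e"
  have lim: "(\<lambda>j. ?I j u' b') \<longlonglongrightarrow> (\<integral>x. soft_half e u' b' x \<partial>\<mu> (frame_span k w))"
  proof (rule mass_assignment_integral_tendsto[OF \<mu> continuous_soft_half[OF \<open>e > 0\<close>] _ v])
    show "\<bar>soft_half e u' b' x\<bar> \<le> 1" for x
      using soft_half_bounds[of e u' b' x] by simp
  qed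
  have "(\<lambda>j. ?r j * total_mass k \<mu> (v j)) \<longlonglongrightarrow> (norm (u' - u') + \<bar>b' - b'\<bar>) / e * total_mass k \<mu> w"
    by (intro tendsto_intros u b total_mass_tendsto[OF \<mu> v]) (use \<open>e > 0\<close> in auto)
  then have "(\<lambda>j. ?r j * total_mass k \<mu> (v j)) \<longlonglongrightarrow> 0" by simp
  then have "(\<lambda>j. ?I j (u j) (b j) - ?I j u' b') \<longlonglongrightarrow> 0"
  proof (rule Lim_null_comparison[rotated], intro always_eventually allI)
    fix j
    note M = mass_assignmentD[OF \<mu> v(1)[of j]]
    have int: "integrable (\<mu> (frame_span k (v j))) (soft_half e a c)" for a c
      using integrable_soft_half[OF M \<open>e > 0\<close>] .
    have "norm (?I j (u j) (b j) - ?I j u' b')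
        = norm (\<integral>x. soft_half e (u j) (b j) x - soft_half e u' b' x \<partial>\<mu> (frame_span k (v j)))"
      using int by (simp add: Bochner_Integration.integral_diff)
    also have "\<dots> \<le> (\<integral>x. norm (soft_half e (u j) (b j) x - soft_half e u' b' x) \<partial>\<mu> (frame_span k (v j)))"
      by (rule integral_norm_bound)
    also have "\<dots> \<le> (\<integral>x. ?r j \<partial>\<mu> (frame_span k (v j)))"
    proof (rule integral_mono)
      show "integrable (\<mu> (frame_span k (v j))) (\<lambda>x. ?r j)"
        using mass_distributionD(2)[OF M] by (intro finite_measure.integrable_const)
      show "norm (soft_half e (u j) (b j) x - soft_half e u' b' x) \<le> ?r j" for x
        using soft_half_lipschitz[OF \<open>e > 0\<close>] by simp
    qed (intro integrable_norm Bochner_Integration.integrable_diff int)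
    also have "\<dots> = ?r j * total_mass k \<mu> (v j)" by (rule integral_const_mass[OF M])
    finally show "norm (?I j (u j) (b j) - ?I j u' b') \<le> ?r j * total_mass k \<mu> (v j)" .
  qed
  from tendsto_add[OF this lim] show ?thesis by simp
qed

lemma dist_flip: "dist (v(i := - v i)) (w(i := - w i)) = dist v (w :: nat \<Rightarrow> 'a::real_normed_vector)"
proof -
  have "dist ((v(i := - v i)) l) ((w(i := - w i)) l) = dist (v l) (w l)" for l
    by (simp add: dist_norm norm_minus_commute)
  then show ?thesis unfolding dist_fun_def by presburger
qed

text \<open>A sign change is an isometry. Distances to sign invariant sets of frames are therefore
  even in every row, as weights on the Grassmannian must be.\<close>

lemma infdist_flip:
  fixes C :: "(nat \<Rightarrow> 'a::real_normed_vector) set"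
  assumes C: "\<And>w. w \<in> C \<Longrightarrow> w(i := - w i) \<in> C"
  shows "infdist (v(i := - v i)) C = infdist v C"
proof -
  have "C = (\<lambda>w. w(i := - w i)) ` C"
  proof (intro equalityI subsetI)
    fix w assume "w \<in> C"
    then have "w(i := - w i) \<in> C" by (rule C)
    moreover have "w = (w(i := - w i))(i := - (w(i := - w i)) i)" by simp
    ultimately show "w \<in> (\<lambda>w. w(i := - w i)) ` C" by blast
  qed (use C in auto)
  then have "(\<lambda>w. dist (v(i := - v i)) w) ` C = (\<lambda>w. dist (v(i := - v i)) w) ` (\<lambda>w. w(i := - w i)) ` C"
    by simp
  also have "\<dots> = (\<lambda>w. dist v w) ` C" by (simp only: image_image dist_flip)
  finally show ?thesis by (simp add: infdist_def)
qed

section \<open>Approximate center transversals\<close>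

lemma frame_span_limit:
  assumes v: "\<And>j. v j \<in> orthonormal_frames k" and "m \<le> k" and u: "\<And>j. u j \<in> frame_span m (v j)"
    and vlim: "v \<longlonglongrightarrow> w" and ulim: "u \<longlonglongrightarrow> u'"
  shows "u' \<in> frame_span m w"
proof -
  have coord: "(\<lambda>j. v j i) \<longlonglongrightarrow> w i" for i using vlim by (simp only: tendsto_fun_iff)
  have "(\<lambda>j. \<Sum>i<m. (u j \<bullet> v j i) *\<^sub>R v j i) \<longlonglongrightarrow> (\<Sum>i<m. (u' \<bullet> w i) *\<^sub>R w i)"
    by (intro tendsto_intros ulim coord)
  then have "u \<longlonglongrightarrow> (\<Sum>i<m. (u' \<bullet> w i) *\<^sub>R w i)"
    by (simp only: frame_span_expand[OF v \<open>m \<le> k\<close> u])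
  with ulim have "u' = (\<Sum>i<m. (u' \<bullet> w i) *\<^sub>R w i)" by (rule LIMSEQ_unique)
  then show ?thesis by (metis frame_span_sum)
qed

text \<open>The frames for which the constant point \<open>q\<close> is not deeper than
  \<open>c\<close>. The weak inequality makes this set closed, and \<open>q\<close> ranges over the
  whole space because only \<open>u \<bullet> q\<close> enters.\<close>

definition shallow_frames ::
  "nat \<Rightarrow> nat \<Rightarrow> ('a::euclidean_space set \<Rightarrow> 'a measure) \<Rightarrow> real \<Rightarrow> real \<Rightarrow> 'a \<Rightarrow> (nat \<Rightarrow> 'a) set" where
  "shallow_frames k m \<mu> e c q = {v \<in> orthonormal_frames k. \<exists>u\<in>frame_span m v. norm u = 1 \<and>
    (\<integral>x. soft_half e u (u \<bullet> q) x \<partial>\<mu> (frame_span k v)) \<le> c * total_mass k \<mu> v}"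

lemma closed_shallow_frames:
  assumes \<mu>: "mass_assignment k \<mu>" and "e > 0" "m \<le> k"
  shows "closed (shallow_frames k m \<mu> e c q)"
  unfolding closed_sequential_limits
proof (intro allI impI, elim conjE)
  fix v w assume v: "\<forall>j. v j \<in> shallow_frames k m \<mu> e c q" and lim: "v \<longlonglongrightarrow> w"
  then have vo: "v j \<in> orthonormal_frames k" for j by (auto simp: shallow_frames_def)
  have w: "w \<in> orthonormal_frames k"
    using compact_imp_closed[OF compact_orthonormal_frames] vo lim unfolding closed_sequential_limits by blast
  obtain u where u: "\<And>j. u j \<in> frame_span m (v j)" "\<And>j. u j \<in> sphere 0 1"
    "\<And>j. (\<integral>x. soft_half e (u j) (u j \<bullet> q) x \<partial>\<mu> (frame_span k (v j))) \<le> c * total_mass k \<mu> (v j)"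
    using v unfolding shallow_frames_def mem_Collect_eq by (simp, metis)
  have "compact (sphere (0::'a) 1)" by simp
  then obtain u' r where u': "u' \<in> sphere 0 1" and r: "strict_mono r" and ulim: "(u \<circ> r) \<longlonglongrightarrow> u'"
    using u(2) unfolding compact_eq_seq_compact_metric seq_compact_def by metis
  have vlim: "(v \<circ> r) \<longlonglongrightarrow> w" using lim r by (rule LIMSEQ_subseq_LIMSEQ)
  have span: "u' \<in> frame_span m w"
    by (rule frame_span_limit[OF _ \<open>m \<le> k\<close> _ vlim ulim]) (use vo u(1) in auto)
  have "(\<integral>x. soft_half e u' (u' \<bullet> q) x \<partial>\<mu> (frame_span k w)) \<le> c * total_mass k \<mu> w"
  proof (rule LIMSEQ_le)
    show "(\<lambda>j. \<integral>x. soft_half e ((u \<circ> r) j) ((u \<circ> r) j \<bullet> q) x \<partial>\<mu> (frame_span k ((v \<circ> r) j)))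
        \<longlonglongrightarrow> (\<integral>x. soft_half e u' (u' \<bullet> q) x \<partial>\<mu> (frame_span k w))"
      by (rule soft_half_integral_tendsto[OF \<mu> \<open>e > 0\<close> _ w vlim ulim
            tendsto_inner[OF ulim tendsto_const]]) (simp add: vo)
    show "(\<lambda>j. c * total_mass k \<mu> ((v \<circ> r) j)) \<longlonglongrightarrow> c * total_mass k \<mu> w"
      by (intro tendsto_intros total_mass_tendsto[OF \<mu> _ w vlim]) (use vo in auto)
  qed (use u(3) in auto)
  then show "w \<in> shallow_frames k m \<mu> e c q"
    using w span u' by (auto simp: shallow_frames_def)
qed

lemma flip_shallow_frames:
  assumes "v \<in> shallow_frames k m \<mu> e c q" "i < k"
  shows "v(i := - v i) \<in> shallow_frames k m \<mu> e c q"
  using assms flip_orthonormal_frames[of v k i] unfolding shallow_frames_def mem_Collect_eq frame_span_flip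
  by blast

lemma finite_deep_cover:
  assumes \<mu>: "mass_assignment k \<mu>" and "e > 0" "m \<le> k" and c: "0 \<le> c" "c * real (m + 1) < 1"
  obtains Q where "finite Q" "\<And>v. v \<in> orthonormal_frames k \<Longrightarrow> \<exists>q\<in>Q. v \<notin> shallow_frames k m \<mu> e c q"
proof -
  have "\<exists>q. v \<notin> shallow_frames k m \<mu> e c q" if v: "v \<in> orthonormal_frames k" for v
  proof -
    \<comment> \<open>Halfway between \<open>c\<close> and \<open>1 / (m + 1)\<close>: the
      centerpoint has weak depth \<open>c'\<close>, hence depth strictly above
      \<open>c\<close>.\<close>
    define c' where "c' = (c + 1 / real (m + 1)) / 2"
    have "c < 1 / real (m + 1)" using c(2) by (simp add: pos_less_divide_eq)
    moreover have "c' * real (m + 1) = (c * real (m + 1) + 1) / 2" by (simp add: c'_def field_simps)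
    ultimately have cc: "c < c'" "c' * real (m + 1) < 1" "0 \<le> c'" using c by (auto simp: c'_def)
    note M = mass_assignmentD[OF \<mu> v]
    have dim: "c' * real (dim (frame_span m v) + 1) < 1"
      using cc(2) by (simp only: dim_frame_span[OF v \<open>m \<le> k\<close>])
    obtain q where q: "\<And>u. u \<in> frame_span m v \<Longrightarrow> norm u = 1 \<Longrightarrow>
        c' * total_mass k \<mu> v \<le> (\<integral>x. soft_half e u (u \<bullet> q) x \<partial>\<mu> (frame_span k v))"
      using approximate_centerpoint[OF M subspace_frame_span cc(3) dim] \<open>e > 0\<close> by metis
    have "c * total_mass k \<mu> v < c' * total_mass k \<mu> v"
      using cc(1) mass_distributionD(3)[OF M] by (rule mult_strict_right_mono)
    then have "v \<notin> shallow_frames k m \<mu> e c q" using q by (force simp: shallow_frames_def)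
    then show ?thesis ..
  qed
  then have cover: "orthonormal_frames k \<subseteq> (\<Union>q\<in>UNIV. - shallow_frames k m \<mu> e c q)" by blast
  obtain Q where "finite Q" "orthonormal_frames k \<subseteq> (\<Union>q\<in>Q. - shallow_frames k m \<mu> e c q)"
    by (rule compactE_image[OF compact_orthonormal_frames _ cover])
      (use closed_shallow_frames[OF \<mu> \<open>e > 0\<close> \<open>m \<le> k\<close>] in auto)
  then show thesis by (intro that[of Q]) auto
qed

text \<open>The weights \<open>w i q\<close> are distances to the bad frames: on frames only deep
  points get positive weight, and the weights extend to all of the product of spheres, where
  Borsuk-Ulam is applied. They are even in every row, so component \<open>j\<close> of a section is
  odd in row \<open>j\<close> alone. Comparing every mass with mass 0 takes \<open>s\<close>
  sections for \<open>s + 1\<close> masses.\<close>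

lemma approximate_center_transversal:
  fixes \<mu> :: "nat \<Rightarrow> 'a::euclidean_space set \<Rightarrow> 'a measure"
  assumes m: "0 < m" "m \<le> k" "k \<le> DIM('a)" "s + m \<le> DIM('a)"
    and \<mu>: "\<And>i. i \<le> s \<Longrightarrow> mass_assignment k (\<mu> i)"
    and e: "e > 0" and c: "0 \<le> c" "c * real (m + 1) < 1"
  shows "\<exists>v\<in>orthonormal_frames k. \<exists>p\<in>frame_span m v. \<forall>i\<le>s. \<forall>u\<in>frame_span m v. norm u = 1 \<longrightarrow>
    c * total_mass k (\<mu> i) v \<le> (\<integral>x. soft_half e u (u \<bullet> p) x \<partial>\<mu> i (frame_span k v))"
proof -
  let ?X = "PiE {..<k} (\<lambda>_. sphere (0::'a) 1)"
  let ?C = "\<lambda>i q. shallow_frames k m (\<mu> i) e c q"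
  have "\<forall>i. \<exists>Q. i \<le> s \<longrightarrow> finite Q \<and> (\<forall>v\<in>orthonormal_frames k. \<exists>q\<in>Q. v \<notin> ?C i q)"
    using finite_deep_cover[OF \<mu> e m(2) c] by metis
  then obtain Q where Q: "\<And>i. i \<le> s \<Longrightarrow> finite (Q i)"
    "\<And>i v. i \<le> s \<Longrightarrow> v \<in> orthonormal_frames k \<Longrightarrow> \<exists>q\<in>Q i. v \<notin> ?C i q" by metis
  \<comment> \<open>The constant function 0 is not a frame; inserting it keeps \<open>infdist\<close> away from its junk value on the
    empty set.\<close>
  define w where "w i q v = infdist v (insert (\<lambda>_. 0) (?C i q))" for i q v
  define W where "W i v = (\<Sum>q\<in>Q i. w i q v)" for i v
  define A where "A i v = (\<Sum>q\<in>Q i. w i q v *\<^sub>R q)" for i v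
  \<comment> \<open>The difference of the averages \<open>A / W\<close> of masses
    \<open>Suc l\<close> and 0, with denominators cleared so that continuity needs no positivity of
    \<open>W\<close>.\<close>
  define F where "F c v = (case c of Inl (i, j) \<Rightarrow> v i \<bullet> v j
    | Inr (l, j) \<Rightarrow> (W 0 v *\<^sub>R A (Suc l) v - W (Suc l) v *\<^sub>R A 0 v) \<bullet> v j)"
    for c :: frame_condition and v
  have w_flip: "w i q (v(l := - v l)) = w i q v" if "l < k" for i q v l
    unfolding w_def
  proof (rule infdist_flip)
    show "x(l := - x l) \<in> insert (\<lambda>_. 0) (?C i q)" if "x \<in> insert (\<lambda>_. 0) (?C i q)" for x
      using that flip_shallow_frames[OF _ \<open>l < k\<close>, of x] by (auto simp: fun_eq_iff)
  qed
  have w_nonneg: "0 \<le> w i q v" for i q v by (simp add: w_def infdist_nonneg)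
  have w_pos: "0 < w i q v \<longleftrightarrow> v \<notin> ?C i q" if "i \<le> s" "v \<in> orthonormal_frames k" for i q v
  proof
    have "v 0 \<bullet> v 0 = 1" using orthonormal_frames_inner[OF that(2), of 0 0] m by simp
    then have "v \<noteq> (\<lambda>_. 0)" by auto
    then show "0 < w i q v" if "v \<notin> ?C i q"
      unfolding w_def using that closed_shallow_frames[OF \<mu>[OF \<open>i \<le> s\<close>] e m(2)]
      by (intro infdist_pos_not_in_closed closed_insert) auto
    show "v \<notin> ?C i q" if "0 < w i q v" using that by (auto simp: w_def)
  qed
  have "\<exists>v\<in>?X. \<forall>c\<in>set (section_conditions m s @ pair_conditions 0 k). F c v = 0"
  proof (rule borsuk_ulam_product_spheres[OF admissible_frame_conditions[OF m(2)]])
    show "(if i < m then s + i else i) < DIM('a)" if "i < k" for i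
      using that m by auto
  next
    fix c assume "c \<in> set (section_conditions m s @ pair_conditions 0 k)"
    have coord: "continuous_on ?X (\<lambda>v. v i)" for i
      using continuous_on_product_coordinates by (rule continuous_on_subset) simp
    have "continuous_on ?X (w i q)" for i q
      unfolding w_def by (intro continuous_intros)
    then have "continuous_on ?X (W i)" "continuous_on ?X (A i)" for i
      unfolding W_def A_def by (auto intro!: continuous_intros)
    then show "continuous_on ?X (F c)"
      unfolding F_def by (cases c) (auto intro!: continuous_intros coord)
  next
    fix c l v assume c: "c \<in> set (section_conditions m s @ pair_conditions 0 k)" and l: "l < k"
    have "W i (v(l := - v l)) = W i v" "A i (v(l := - v l)) = A i v" for i
      by (simp_all add: W_def A_def w_flip[OF l])
    then show "F c (v(l := - v l)) = (if l \<in> parity_set c then - F c v else F c v)"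
      using c by (auto simp: F_def set_section_conditions set_pair_conditions)
  qed
  then obtain v where vX: "v \<in> ?X"
    and Fv: "\<And>c. c \<in> set (section_conditions m s @ pair_conditions 0 k) \<Longrightarrow> F c v = 0"
    by blast
  have zero: "v i \<bullet> v j = 0" if "i < j" "j < k" for i j
    using Fv[of "Inl (i, j)"] that by (simp add: F_def set_section_conditions set_pair_conditions)
  have zero': "(W 0 v *\<^sub>R A (Suc l) v - W (Suc l) v *\<^sub>R A 0 v) \<bullet> v j = 0" if "l < s" "j < m" for l j
    using Fv[of "Inr (l, j)"] that by (simp add: F_def set_section_conditions set_pair_conditions)
  have v: "v \<in> orthonormal_frames k" using vX zero by (auto simp: orthonormal_frames_alt)
  have W_pos: "W i v > 0" if i: "i \<le> s" for i
  proof -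
    obtain q where "q \<in> Q i" "v \<notin> ?C i q" using Q(2)[OF i v] by blast
    then show ?thesis unfolding W_def using w_pos[OF i v] w_nonneg
      by (intro sum_pos2[OF Q(1)[OF i]]) auto
  qed
  \<comment> \<open>The common point: by \<open>zero'\<close> all averages have the same projection
    to \<open>L\<close>.\<close>
  define p where "p = (\<Sum>j<m. ((A 0 v /\<^sub>R W 0 v) \<bullet> v j) *\<^sub>R v j)"
  have p: "u \<bullet> p = u \<bullet> (A i v /\<^sub>R W i v)" if i: "i \<le> s" and u: "u \<in> frame_span m v" for i u
  proof -
    have "(A i v /\<^sub>R W i v) \<bullet> v j = (A 0 v /\<^sub>R W 0 v) \<bullet> v j" if j: "j < m" for j
    proof (cases i)
      case (Suc l)
      have "W 0 v * (A i v \<bullet> v j) = W i v * (A 0 v \<bullet> v j)"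
        using zero'[of l j] i j by (simp add: Suc inner_diff_left)
      then show ?thesis using W_pos[OF i] W_pos[of 0] by (simp add: field_simps)
    qed simp
    then have "u \<bullet> p = (\<Sum>j<m. ((A i v /\<^sub>R W i v) \<bullet> v j) * (u \<bullet> v j))"
      unfolding p_def by (simp add: inner_sum_right)
    also have "\<dots> = (\<Sum>j<m. (u \<bullet> v j) *\<^sub>R v j) \<bullet> (A i v /\<^sub>R W i v)"
      unfolding inner_sum_left by (intro sum.cong refl) (simp add: inner_commute)
    also have "\<dots> = u \<bullet> (A i v /\<^sub>R W i v)"
      by (simp only: frame_span_expand[OF v m(2) u])
    finally show ?thesis .
  qed
  have "c * total_mass k (\<mu> i) v \<le> (\<integral>x. soft_half e u (u \<bullet> p) x \<partial>\<mu> i (frame_span k v))"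
    if i: "i \<le> s" and u: "u \<in> frame_span m v" "norm u = 1" for i u
  proof -
    \<comment> \<open>A weighted average cannot exceed all its points in direction \<open>u\<close>.
      Passing from such a \<open>q\<close> to \<open>p\<close> lowers the threshold and so only
      enlarges the cutoff.\<close>
    have "\<exists>q\<in>Q i. 0 < w i q v \<and> u \<bullet> p \<le> u \<bullet> q"
    proof (rule ccontr)
      assume "\<not> ?thesis"
      then have le: "w i q v * (u \<bullet> q) \<le> w i q v * (u \<bullet> p)" and
        less: "0 < w i q v \<Longrightarrow> w i q v * (u \<bullet> q) < w i q v * (u \<bullet> p)" if "q \<in> Q i" for q
        using that w_nonneg[of i q v] by (cases "w i q v = 0"; force)+
      obtain q where q: "q \<in> Q i" "0 < w i q v" using Q(2)[OF i v] w_pos[OF i v] by blast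
      have "(\<Sum>q\<in>Q i. w i q v * (u \<bullet> q)) < (\<Sum>q\<in>Q i. w i q v * (u \<bullet> p))"
        by (rule sum_strict_mono_ex1[OF Q(1)[OF i]]) (use le less[OF q] q(1) in blast)+
      also have "\<dots> = W i v * (u \<bullet> p)" by (simp add: W_def sum_distrib_right)
      also have "(\<Sum>q\<in>Q i. w i q v * (u \<bullet> q)) = u \<bullet> A i v"
        by (simp add: A_def inner_sum_right)
      finally show False using p[OF i u(1)] W_pos[OF i] by (simp add: field_simps)
    qed
    then obtain q where q: "0 < w i q v" "u \<bullet> p \<le> u \<bullet> q" by blast
    note M = mass_assignmentD[OF \<mu>[OF i] v]
    have "c * total_mass k (\<mu> i) v \<le> (\<integral>x. soft_half e u (u \<bullet> q) x \<partial>\<mu> i (frame_span k v))"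
      using q(1) w_pos[OF i v] u v by (auto simp: shallow_frames_def)
    also have "\<dots> \<le> (\<integral>x. soft_half e u (u \<bullet> p) x \<partial>\<mu> i (frame_span k v))"
      by (intro integral_mono integrable_soft_half[OF M e] soft_half_antimono[OF e q(2)])
    finally show ?thesis .
  qed
  moreover have "p \<in> frame_span m v" unfolding p_def by (rule frame_span_sum)
  ultimately show ?thesis using v by blast
qed

section \<open>Center transversals\<close>

text \<open>Otherwise bad frames for all \<open>R\<close> accumulate at some \<open>w\<close>. The
  truncations decrease in \<open>R\<close>, so for each fixed \<open>R\<close> the bad inequality
  passes to \<open>w\<close>; letting \<open>R\<close> grow there contradicts dominated
  convergence.\<close>

lemma uniformly_tight:
  assumes \<mu>: "mass_assignment k \<mu>" and "c > 0"
  obtains R :: nat where "\<And>v. v \<in> orthonormal_frames k \<Longrightarrow>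
    (\<integral>x. max 0 (min 1 (norm x - real R)) \<partial>\<mu> (frame_span k v)) < c * total_mass k \<mu> v"
proof (rule ccontr)
  let ?f = "\<lambda>R x. max 0 (min 1 (norm x - real R))"
  assume "\<not> thesis"
  then have "\<forall>R. \<exists>v\<in>orthonormal_frames k. c * total_mass k \<mu> v \<le> (\<integral>x. ?f R x \<partial>\<mu> (frame_span k v))"
    using that by (metis not_le)
  then obtain v where v: "\<And>R. v R \<in> orthonormal_frames k"
    "\<And>R. c * total_mass k \<mu> (v R) \<le> (\<integral>x. ?f R x \<partial>\<mu> (frame_span k (v R)))" by metis
  obtain w r where w: "w \<in> orthonormal_frames k" and r: "strict_mono r" and lim: "(v \<circ> r) \<longlonglongrightarrow> w"
    using v(1) compact_orthonormal_frames unfolding compact_eq_seq_compact_metric seq_compact_def by metis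
  have cont: "continuous_on UNIV (?f R)" for R by (intro continuous_intros)
  have bound: "\<bar>?f R x\<bar> \<le> 1" for R x by simp
  have int: "integrable (\<mu> (frame_span k x)) (?f R)" if "x \<in> orthonormal_frames k" for x R
    by (rule mass_distribution_integrable[OF mass_assignmentD[OF \<mu> that] cont bound])
  have *: "c * total_mass k \<mu> w \<le> (\<integral>x. ?f R x \<partial>\<mu> (frame_span k w))" for R
  proof (rule LIMSEQ_le)
    show "(\<lambda>j. c * total_mass k \<mu> ((v \<circ> r) j)) \<longlonglongrightarrow> c * total_mass k \<mu> w"
      by (intro tendsto_intros total_mass_tendsto[OF \<mu> _ w lim]) (simp add: v(1))
    show "(\<lambda>j. \<integral>x. ?f R x \<partial>\<mu> (frame_span k ((v \<circ> r) j))) \<longlonglongrightarrow> (\<integral>x. ?f R x \<partial>\<mu> (frame_span k w))"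
      by (rule mass_assignment_integral_tendsto[OF \<mu> cont bound _ w lim]) (simp add: v(1))
    show "\<exists>N. \<forall>j\<ge>N. c * total_mass k \<mu> ((v \<circ> r) j) \<le> (\<integral>x. ?f R x \<partial>\<mu> (frame_span k ((v \<circ> r) j)))"
    proof (intro exI allI impI)
      fix j assume "R \<le> j"
      then have "R \<le> r j" using seq_suble[OF r, of j] by linarith
      have "c * total_mass k \<mu> (v (r j)) \<le> (\<integral>x. ?f (r j) x \<partial>\<mu> (frame_span k (v (r j))))" by (rule v(2))
      also have "\<dots> \<le> (\<integral>x. ?f R x \<partial>\<mu> (frame_span k (v (r j))))"
        by (intro integral_mono int v(1)) (use \<open>R \<le> r j\<close> in auto)
      finally show "c * total_mass k \<mu> ((v \<circ> r) j) \<le> (\<integral>x. ?f R x \<partial>\<mu> (frame_span k ((v \<circ> r) j)))"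
        by simp
    qed
  qed
  note M = mass_assignmentD[OF \<mu> w]
  have "(\<lambda>R. \<integral>x. ?f R x \<partial>\<mu> (frame_span k w)) \<longlonglongrightarrow> (\<integral>x. 0 \<partial>\<mu> (frame_span k w))"
  proof (rule integral_dominated_convergence)
    show "integrable (\<mu> (frame_span k w)) (\<lambda>x. 1::real)"
      using mass_distributionD(2)[OF M] by (intro finite_measure.integrable_const)
    show "AE x in \<mu> (frame_span k w). (\<lambda>R. ?f R x) \<longlonglongrightarrow> 0"
    proof (rule AE_I2)
      fix x :: 'a
      obtain R0 where "norm x \<le> real R0" using real_arch_simple by blast
      then have "\<forall>R\<ge>R0. ?f R x = 0" by auto
      then show "(\<lambda>R. ?f R x) \<longlonglongrightarrow> 0"
        by (intro tendsto_eventually) (auto simp: eventually_sequentially)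
    qed
    show "?f R \<in> borel_measurable (\<mu> (frame_span k w))" for R
      by (rule mass_distribution_measurable[OF M cont])
  qed auto
  then have "c * total_mass k \<mu> w \<le> 0"
    by (intro LIMSEQ_le_const[of _ "0::real"]) (use * in auto)
  then show False using \<open>c > 0\<close> mass_distributionD(3)[OF M] by (simp add: mult_le_0_iff)
qed

lemma norm_frame_sum:
  assumes "v \<in> orthonormal_frames k" "m \<le> k"
  shows "(norm (\<Sum>l<m. a l *\<^sub>R v l))\<^sup>2 = (\<Sum>l<m. (a l)\<^sup>2)"
proof -
  have "(norm (\<Sum>l<m. a l *\<^sub>R v l))\<^sup>2 = (\<Sum>i<m. \<Sum>j<m. a i * (a j * (v j \<bullet> v i)))"
    by (simp add: power2_norm_eq_inner inner_sum_left inner_sum_right sum_distrib_left)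
  also have "\<dots> = (\<Sum>i<m. \<Sum>j<m. if i = j then (a i)\<^sup>2 else 0)"
    by (intro sum.cong refl) (use assms in \<open>auto simp: orthonormal_frames_inner power2_eq_square\<close>)
  finally show ?thesis by simp
qed

lemma center_transversal_direction:
  fixes \<mu> :: "nat \<Rightarrow> 'a::euclidean_space set \<Rightarrow> 'a measure"
  assumes m: "0 < m" "m \<le> k" "k \<le> DIM('a)" "s + m \<le> DIM('a)"
    and \<mu>: "\<And>i. i \<le> s \<Longrightarrow> mass_assignment k (\<mu> i)"
  shows "\<exists>v\<in>orthonormal_frames k. \<exists>p\<in>frame_span m v. \<forall>i\<le>s. \<forall>u\<in>frame_span m v. norm u = 1 \<longrightarrow>
    1 / real (m + 1) * total_mass k (\<mu> i) v
      \<le> measure (\<mu> i (frame_span k v)) {x \<in> frame_span k v. u \<bullet> p \<le> u \<bullet> x}"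
proof -
  define e where "e j = inverse (real (Suc j))" for j
  \<comment> \<open>Strictly below \<open>1 / (m + 1)\<close>, yet at least half of it; the lower
    bound is what tightness is played against.\<close>
  define c where "c j = 1 / real (m + 1) * (1 - inverse (real (Suc (Suc j))))" for j
  have e: "0 < e j" "e j \<le> 1" for j by (auto simp: e_def field_simps)
  have inv: "0 < inverse (real (Suc (Suc j)))" "inverse (real (Suc (Suc j))) \<le> 1 / 2" for j
    by (auto simp: field_simps)
  have cm: "c j * real (m + 1) = 1 - inverse (real (Suc (Suc j)))" for j by (simp add: c_def)
  have c_ge: "1 / real (m + 1) * (1 / 2) \<le> c j" for j
    unfolding c_def by (rule mult_left_mono) (use inv(2)[of j] in auto)
  then have c: "0 \<le> c j" "c j * real (m + 1) < 1" for j
    using inv(1)[of j] by (intro order_trans[OF _ c_ge], simp) (simp only: cm, simp)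
  have c_lim: "c \<longlonglongrightarrow> 1 / real (m + 1)"
  proof -
    have "(\<lambda>j. 1 / real (m + 1) * (1 - inverse (real (Suc (Suc j))))) \<longlonglongrightarrow> 1 / real (m + 1) * (1 - 0)"
      by (intro tendsto_intros LIMSEQ_Suc[OF LIMSEQ_inverse_real_of_nat])
    then show ?thesis by (simp add: c_def[abs_def])
  qed
  have "\<forall>j. \<exists>v p. v \<in> orthonormal_frames k \<and> p \<in> frame_span m v \<and>
    (\<forall>i\<le>s. \<forall>u\<in>frame_span m v. norm u = 1 \<longrightarrow>
      c j * total_mass k (\<mu> i) v \<le> (\<integral>x. soft_half (e j) u (u \<bullet> p) x \<partial>\<mu> i (frame_span k v)))"
    using approximate_center_transversal[OF m, of \<mu>] \<mu> e(1) c by metis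
  then obtain v p where v: "\<And>j. v j \<in> orthonormal_frames k" and p: "\<And>j. p j \<in> frame_span m (v j)"
    and deep: "\<And>j i u. i \<le> s \<Longrightarrow> u \<in> frame_span m (v j) \<Longrightarrow> norm u = 1 \<Longrightarrow>
      c j * total_mass k (\<mu> i) (v j) \<le> (\<integral>x. soft_half (e j) u (u \<bullet> p j) x \<partial>\<mu> i (frame_span k (v j)))"
    by metis
  obtain R :: nat where R: "\<And>v. v \<in> orthonormal_frames k \<Longrightarrow>
    (\<integral>x. max 0 (min 1 (norm x - real R)) \<partial>\<mu> 0 (frame_span k v)) < 1 / real (m + 1) * (1 / 2) * total_mass k (\<mu> 0) v"
    using uniformly_tight[OF \<mu>[of 0], of "1 / real (m + 1) * (1 / 2)"] by auto
  \<comment> \<open>If \<open>norm x < R + 1\<close> and \<open>e j \<le> 1\<close>, then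
    \<open>norm x + 2 * e j * (1 + norm x)\<close> is below \<open>3 * R + 5\<close>. A point
    \<open>p j\<close> beyond this radius would have a cutoff vanishing on that ball.\<close>
  define B where "B = 3 * real R + 5"
  have p_bound: "norm (p j) \<le> B" for j
  proof (rule ccontr)
    assume "\<not> norm (p j) \<le> B"
    then have big: "3 * real R + 5 < norm (p j)" by (simp add: B_def)
    then have "p j \<noteq> 0" by auto
    note M = mass_assignmentD[OF \<mu>[of 0] v[of j], OF le0]
    let ?u = "sgn (p j)"
    have u: "?u \<in> frame_span m (v j)" "norm ?u = 1"
      using p[of j] \<open>p j \<noteq> 0\<close> by (auto simp: sgn_div_norm frame_span_def span_scale)
    have up: "?u \<bullet> p j = norm (p j)"
      using \<open>p j \<noteq> 0\<close> by (simp add: sgn_div_norm dot_square_norm power2_eq_square)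
    have "c j * total_mass k (\<mu> 0) (v j) \<le> (\<integral>x. soft_half (e j) ?u (?u \<bullet> p j) x \<partial>\<mu> 0 (frame_span k (v j)))"
      by (rule deep[OF _ u]) simp
    also have "\<dots> \<le> (\<integral>x. max 0 (min 1 (norm x - real R)) \<partial>\<mu> 0 (frame_span k (v j)))"
    proof (rule integral_mono)
      show "integrable (\<mu> 0 (frame_span k (v j))) (\<lambda>x. max 0 (min 1 (norm x - real R)))"
        by (rule mass_distribution_integrable[OF M, where B = 1]) (auto intro!: continuous_intros)
      fix x :: 'a
      show "soft_half (e j) ?u (?u \<bullet> p j) x \<le> max 0 (min 1 (norm x - real R))"
      proof (cases "norm x \<ge> real R + 1")
        case True
        then show ?thesis using soft_half_bounds(2)[of "e j" ?u "?u \<bullet> p j" x] by simp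
      next
        case False
        have "?u \<bullet> x \<le> norm x" using norm_cauchy_schwarz[of ?u x] u(2) by simp
        moreover have "e j * (1 + norm x) \<le> 1 * (1 + norm x)"
          by (rule mult_right_mono) (use e(2) in auto)
        ultimately have "?u \<bullet> x - ?u \<bullet> p j \<le> - 2 * e j * (1 + norm x)"
          using False big unfolding up by (simp add: algebra_simps)
        then have "soft_half (e j) ?u (?u \<bullet> p j) x = 0" by (rule soft_half_eq_0[OF e(1)])
        then show ?thesis by simp
      qed
    qed (use integrable_soft_half[OF M e(1)] in simp)
    also have "\<dots> < 1 / real (m + 1) * (1 / 2) * total_mass k (\<mu> 0) (v j)" by (rule R[OF v])
    also have "\<dots> \<le> c j * total_mass k (\<mu> 0) (v j)"
      by (rule mult_right_mono[OF c_ge]) simp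
    finally show False by simp
  qed
  obtain w r1 where w: "w \<in> orthonormal_frames k" and r1: "strict_mono r1" and lim1: "(v \<circ> r1) \<longlonglongrightarrow> w"
    using v compact_orthonormal_frames unfolding compact_eq_seq_compact_metric seq_compact_def by metis
  have "\<forall>j. (p \<circ> r1) j \<in> cball 0 B" using p_bound by simp
  then obtain q r2 where r2: "strict_mono r2" and lim2: "((p \<circ> r1) \<circ> r2) \<longlonglongrightarrow> q"
    using compact_cball[of 0 B] unfolding compact_eq_seq_compact_metric seq_compact_def by metis
  define r where "r = r1 \<circ> r2"
  have r: "strict_mono r" unfolding r_def by (rule strict_mono_o[OF r1 r2])
  have vlim: "(\<lambda>j. v (r j)) \<longlonglongrightarrow> w" using LIMSEQ_subseq_LIMSEQ[OF lim1 r2] by (simp add: r_def o_def)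
  have plim: "(\<lambda>j. p (r j)) \<longlonglongrightarrow> q" using lim2 by (simp add: r_def o_def)
  have q: "q \<in> frame_span m w"
    by (rule frame_span_limit[OF _ m(2) _ vlim plim]) (use v p in auto)
  have "1 / real (m + 1) * total_mass k (\<mu> i) w
      \<le> measure (\<mu> i (frame_span k w)) {x \<in> frame_span k w. u \<bullet> q \<le> u \<bullet> x}"
    if i: "i \<le> s" and u: "u \<in> frame_span m w" "norm u = 1" for i u
  proof -
    \<comment> \<open>The direction \<open>u\<close> carried to the frame \<open>v (r j)\<close>
      with the same coordinates, hence again a unit vector.\<close>
    define y where "y j = (\<Sum>l<m. (u \<bullet> w l) *\<^sub>R v (r j) l)" for j
    have y_span: "y j \<in> frame_span m (v (r j))" for j unfolding y_def by (rule frame_span_sum)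
    have "(norm (y j))\<^sup>2 = (norm u)\<^sup>2" for j
      using norm_frame_sum[OF v m(2)] norm_frame_sum[OF w m(2), of "\<lambda>l. u \<bullet> w l"]
      by (simp add: y_def frame_span_expand[OF w m(2) u(1)])
    then have y_norm: "norm (y j) = 1" for j using u(2) by (metis power2_eq_imp_eq norm_ge_zero)
    have "(\<lambda>j. v (r j) l) \<longlonglongrightarrow> w l" for l using vlim by (simp only: tendsto_fun_iff)
    then have "y \<longlonglongrightarrow> (\<Sum>l<m. (u \<bullet> w l) *\<^sub>R w l)" unfolding y_def by (intro tendsto_intros)
    then have ylim: "y \<longlonglongrightarrow> u" by (simp only: frame_span_expand[OF w m(2) u(1)])
    note M = mass_assignmentD[OF \<mu>[OF i] w]
    let ?H = "{x. u \<bullet> q \<le> u \<bullet> x}"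
    \<comment> \<open>The width \<open>e J\<close> stays fixed while the frames converge, which is
      possible because the cutoff grows with its width. Only afterwards does \<open>J\<close> tend
      to infinity.\<close>
    have soft: "1 / real (m + 1) * total_mass k (\<mu> i) w \<le> (\<integral>x. soft_half (e J) u (u \<bullet> q) x \<partial>\<mu> i (frame_span k w))" for J
    proof (rule LIMSEQ_le)
      show "(\<lambda>j. c (r j) * total_mass k (\<mu> i) (v (r j))) \<longlonglongrightarrow> 1 / real (m + 1) * total_mass k (\<mu> i) w"
        using LIMSEQ_subseq_LIMSEQ[OF c_lim r]
        by (intro tendsto_mult total_mass_tendsto[OF \<mu>[OF i] _ w vlim]) (auto simp: o_def v)
      show "(\<lambda>j. \<integral>x. soft_half (e J) (y j) (y j \<bullet> p (r j)) x \<partial>\<mu> i (frame_span k (v (r j))))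
          \<longlonglongrightarrow> (\<integral>x. soft_half (e J) u (u \<bullet> q) x \<partial>\<mu> i (frame_span k w))"
        by (rule soft_half_integral_tendsto[OF \<mu>[OF i] e(1) _ w vlim ylim tendsto_inner[OF ylim plim]]) (rule v)
      show "\<exists>N. \<forall>j\<ge>N. c (r j) * total_mass k (\<mu> i) (v (r j))
          \<le> (\<integral>x. soft_half (e J) (y j) (y j \<bullet> p (r j)) x \<partial>\<mu> i (frame_span k (v (r j))))"
      proof (intro exI allI impI)
        fix j assume "J \<le> j"
        then have "J \<le> r j" using seq_suble[OF r, of j] by linarith
        then have "e (r j) \<le> e J" by (simp add: e_def)
        note M' = mass_assignmentD[OF \<mu>[OF i] v[of "r j"]]
        have "c (r j) * total_mass k (\<mu> i) (v (r j))
          \<le> (\<integral>x. soft_half (e (r j)) (y j) (y j \<bullet> p (r j)) x \<partial>\<mu> i (frame_span k (v (r j))))"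
          by (rule deep[OF i y_span y_norm])
        also have "\<dots> \<le> (\<integral>x. soft_half (e J) (y j) (y j \<bullet> p (r j)) x \<partial>\<mu> i (frame_span k (v (r j))))"
          by (intro integral_mono integrable_soft_half[OF M'] e(1) soft_half_mono \<open>e (r j) \<le> e J\<close>)
        finally show "c (r j) * total_mass k (\<mu> i) (v (r j))
          \<le> (\<integral>x. soft_half (e J) (y j) (y j \<bullet> p (r j)) x \<partial>\<mu> i (frame_span k (v (r j))))" .
      qed
    qed
    have H: "?H \<inter> frame_span k w \<in> sets (\<mu> i (frame_span k w))"
      using mass_distributionD(5)[OF M closed_halfspace_ge[of "u \<bullet> q" u]] by simp
    have meas: "(indicator ?H :: _ \<Rightarrow> real) \<in> borel_measurable (\<mu> i (frame_span k w))"
      using H mass_distributionD(1)[OF M] by (simp add: borel_measurable_indicator_iff)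
    have "(\<lambda>J. \<integral>x. soft_half (e J) u (u \<bullet> q) x \<partial>\<mu> i (frame_span k w))
        \<longlonglongrightarrow> (\<integral>x. indicator ?H x \<partial>\<mu> i (frame_span k w))"
    proof (rule integral_dominated_convergence[OF meas])
      show "integrable (\<mu> i (frame_span k w)) (\<lambda>x. 1::real)"
        using mass_distributionD(2)[OF M] by (intro finite_measure.integrable_const)
      show "soft_half (e J) u (u \<bullet> q) \<in> borel_measurable (\<mu> i (frame_span k w))" for J
        by (rule mass_distribution_measurable[OF M continuous_soft_half[OF e(1)]])
      show "AE x in \<mu> i (frame_span k w). (\<lambda>J. soft_half (e J) u (u \<bullet> q) x) \<longlonglongrightarrow> indicator ?H x"
        unfolding e_def by (intro AE_I2 soft_half_tendsto)
      show "AE x in \<mu> i (frame_span k w). norm (soft_half (e J) u (u \<bullet> q) x) \<le> 1" for J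
        by (intro AE_I2) (simp add: soft_half_bounds abs_of_nonneg)
    qed
    then have "1 / real (m + 1) * total_mass k (\<mu> i) w \<le> (\<integral>x. indicator ?H x \<partial>\<mu> i (frame_span k w))"
      by (rule LIMSEQ_le_const) (use soft in auto)
    also have "\<dots> = measure (\<mu> i (frame_span k w)) (?H \<inter> frame_span k w)"
      using mass_distributionD(1)[OF M] by simp
    also have "?H \<inter> frame_span k w = {x \<in> frame_span k w. u \<bullet> q \<le> u \<bullet> x}" by auto
    finally show ?thesis .
  qed
  then show ?thesis using w q by blast
qed

text \<open>The normal of a halfspace containing \<open>g\<close> is orthogonal to the direction
  space \<open>N\<close> of \<open>g\<close>, hence lies in \<open>L\<close>. So the halfspace
  contains one with normal in \<open>L\<close> and boundary through \<open>p\<close>, whose mass is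
  controlled.\<close>

theorem theorem2:
  fixes n k :: nat
    and \<mu> :: "nat \<Rightarrow> (real ^ 'd) set \<Rightarrow> (real ^ 'd) measure"
  assumes "1 \<le> n" and "n \<le> k" and "k \<le> CARD('d)"
    and "\<And>i. i \<in> {1..n + CARD('d) - k} \<Longrightarrow> mass_assignment k (\<mu> i)"
  shows "\<exists>h \<in> grassmannian k. \<exists>g.
    common_center_transversal n k h {1..n + CARD('d) - k} (\<lambda>i. \<mu> i h) g"
proof -
  \<comment> \<open>Here \<open>s + m = CARD('d)\<close>, and there are \<open>s + 1\<close> masses;
    their indices start at 1, whence the shift by \<open>Suc\<close>.\<close>
  define m where "m = k - n + 1"
  define s where "s = n + CARD('d) - k - 1"
  have m: "0 < m" "m \<le> k" "k \<le> DIM(real ^ 'd)" "s + m \<le> DIM(real ^ 'd)"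
    using assms(1-3) by (auto simp: m_def s_def)
  have \<mu>': "mass_assignment k (\<mu> (Suc i))" if "i \<le> s" for i
    by (rule assms(4)) (use that assms(1-3) in \<open>auto simp: s_def\<close>)
  obtain v p where v: "v \<in> orthonormal_frames k" and p: "p \<in> frame_span m v"
    and deep: "\<And>i u. i \<le> s \<Longrightarrow> u \<in> frame_span m v \<Longrightarrow> norm u = 1 \<Longrightarrow>
      1 / real (m + 1) * total_mass k (\<mu> (Suc i)) v
      \<le> measure (\<mu> (Suc i) (frame_span k v)) {x \<in> frame_span k v. u \<bullet> p \<le> u \<bullet> x}"
    using center_transversal_direction[OF m, of "\<lambda>i. \<mu> (Suc i)"] \<mu>' by blast
  define h where "h = frame_span k v"
  define N where "N = span (v ` {m..<k})"
  define g where "g = (+) p ` N"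
  have h: "h \<in> grassmannian k" unfolding h_def by (rule frame_span_in_grassmannian[OF v])
  have sub_h: "subspace h" unfolding h_def by (rule subspace_frame_span)
  have sub_N: "subspace N" by (simp add: N_def)
  have "N \<subseteq> h" unfolding N_def h_def frame_span_def by (rule span_mono) auto
  have "frame_span m v \<subseteq> h" unfolding h_def frame_span_def by (rule span_mono) (use m in auto)
  have inj: "inj_on v {..<k}"
    using orthonormal_frames_inner[OF v] by (intro inj_onI) (metis lessThan_iff zero_neq_one)
  have "dim N = n - 1"
  proof -
    have "pairwise orthogonal (v ` {m..<k})"
      using orthonormal_frames_inner[OF v] by (auto simp: pairwise_def orthogonal_def)
    moreover have "0 \<notin> v ` {m..<k}"
      using orthonormal_frames_inner[OF v] by force
    ultimately have "independent (v ` {m..<k})" by (rule pairwise_orthogonal_independent)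
    moreover have "inj_on v {m..<k}" using inj by (rule inj_on_subset) auto
    then have "card (v ` {m..<k}) = k - m" by (simp add: card_image)
    ultimately show ?thesis using assms(1,2) by (simp add: N_def dim_eq_card_independent m_def)
  qed
  have "common_center_transversal n k h {1..n + CARD('d) - k} (\<lambda>i. \<mu> i h) g"
    unfolding common_center_transversal_def
  proof (intro conjI ballI allI impI)
    show "affine g" unfolding g_def
      by (simp add: affine_translation[symmetric] subspace_imp_affine sub_N)
    show "g \<subseteq> h"
      using sub_h \<open>N \<subseteq> h\<close> p \<open>frame_span m v \<subseteq> h\<close> by (auto simp: g_def intro: subspace_add)
    show "aff_dim g = int n - 1"
      unfolding g_def aff_dim_translation_eq
      using \<open>dim N = n - 1\<close> assms(1) by (simp add: aff_dim_subspace[OF sub_N])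
  next
    fix i H assume i: "i \<in> {1..n + CARD('d) - k}" and H': "closed_halfspace_in h H \<and> g \<subseteq> H"
    then have H: "closed_halfspace_in h H" "g \<subseteq> H" by auto
    define j where "j = i - 1"
    have j: "i = Suc j" "j \<le> s" using i assms(1-3) by (auto simp: j_def s_def)
    obtain a b where a: "a \<in> h" "a \<noteq> 0" "H = {x \<in> h. a \<bullet> x \<le> b}"
      using H(1) by (auto simp: closed_halfspace_in_def)
    have perp: "a \<bullet> y = 0" if y: "y \<in> N" for y
    proof (rule ccontr)
      assume ne: "a \<bullet> y \<noteq> 0"
      \<comment> \<open>Chosen so that
        \<open>a \<bullet> (p + t *\<^sub>R y) = b + 1\<close>.\<close>
      define t where "t = (b - a \<bullet> p + 1) / (a \<bullet> y)"
      have "p + t *\<^sub>R y \<in> H" using H(2) subspace_scale[OF sub_N y] by (auto simp: g_def)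
      then have "a \<bullet> p + t * (a \<bullet> y) \<le> b" by (simp add: a(3) inner_add_right)
      then show False using ne by (simp add: t_def)
    qed
    have "0 \<in> N" using sub_N by (rule subspace_0)
    then have "p \<in> H" using H(2) by (force simp: g_def)
    then have pb: "a \<bullet> p \<le> b" by (simp add: a(3))
    have "a = (\<Sum>l<k. (a \<bullet> v l) *\<^sub>R v l)"
      using frame_span_expand[OF v order_refl] a(1) by (simp add: h_def)
    also have "\<dots> = (\<Sum>l<m. (a \<bullet> v l) *\<^sub>R v l)"
    proof (rule sum.mono_neutral_right)
      show "\<forall>l\<in>{..<k} - {..<m}. (a \<bullet> v l) *\<^sub>R v l = 0"
        using perp by (auto simp: N_def span_base)
    qed (use m in auto)
    finally have "a \<in> frame_span m v" by (metis frame_span_sum)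
    \<comment> \<open>The fact \<open>deep\<close> concerns halfspaces bounded from below in
      direction \<open>u\<close>, while \<open>H\<close> is bounded from above in direction
      \<open>a\<close>.\<close>
    then have u: "- sgn a \<in> frame_span m v" "norm (- sgn a) = 1"
      using a(2) by (auto simp: sgn_div_norm frame_span_def span_neg span_scale)
    note M = mass_assignmentD[OF assms(4)[OF i] v, folded h_def]
    interpret finite_measure "\<mu> i h" using mass_distributionD(2)[OF M] .
    have "1 / real (m + 1) * measure (\<mu> i h) h
      \<le> measure (\<mu> i h) {x \<in> h. - sgn a \<bullet> p \<le> - sgn a \<bullet> x}"
      using deep[OF j(2) u] by (simp add: j(1) h_def)
    also have "\<dots> \<le> measure (\<mu> i h) H"
    proof (rule finite_measure_mono)
      have "a \<bullet> x \<le> b" if "- sgn a \<bullet> p \<le> - sgn a \<bullet> x" for x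
      proof -
        have "(a \<bullet> x) / norm a \<le> (a \<bullet> p) / norm a"
          using that by (simp add: sgn_div_norm inner_commute divide_inverse mult.commute)
        then show ?thesis using a(2) pb by (simp add: divide_le_cancel)
      qed
      then show "{x \<in> h. - sgn a \<bullet> p \<le> - sgn a \<bullet> x} \<subseteq> H" by (auto simp: a(3))
      have "{x. a \<bullet> x \<le> b} \<inter> h \<in> sets (\<mu> i h)"
        by (rule mass_distributionD(5)[OF M closed_halfspace_le])
      then show "H \<in> sets (\<mu> i h)" by (simp add: a(3) Collect_conj_eq Int_commute)
    qed
    also have "real (m + 1) = real k - real n + 2"
      using assms(2) by (simp add: m_def of_nat_diff)
    finally show "1 / (real k - real n + 2) * measure (\<mu> i h) h \<le> measure (\<mu> i h) H" .
  qed
  then show ?thesis using h by blast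
qed

end
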